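(* Assume the Planted Clique Hypothesis (stated in the context) holds for a fixed $0<\gamma\le 1/2$. Let $m_0=\lfloor \log_2(1/\gamma)\rfloor$. Let $\alpha>0$ and $0<\beta<1$ be such that $$\alpha<\beta<\frac12+\frac{m_0\alpha+4}{4m_0\alpha+4}\,\alpha-\frac{2}{m_0\alpha}.$$ Then there exists a sequence $\{(N_\ell,K_\ell,q_\ell)\}_{\ell\in\mathbb N}$ satisfying $$\lim_{\ell\to\infty}\frac{\log\frac1{q_\ell}}{\log N_\ell}=\alpha,\qquad \lim_{\ell\to\infty}\frac{\log K_\ell}{\log N_\ell}=\beta$$ such that for any sequence of randomized polynomial-time tests $\phi_\ell:\{0,1\}^{\binom{N_\ell}{2}}\to\{0,1\}$ for the planted dense subgraph detection problem $\mathsf{PDS}(N_\ell,K_\ell,2q_\ell,q_\ell)$, the Type-I+II error probability satisfies $$\liminf_{\ell\to\infty}\ \Big(\mathbb P_0\{\phi_\ell(G')=1\}+\mathbb P_1\{\phi_\ell(G')=0\}\Big)\ge 1,$$ where $G'\sim\mathcal G(N_\ell,q_\ell)$ under $\mathbb P_0$ and $G'\sim\mathcal G(N_\ell,K_\ell,2q_\ell,q_\ell)$ under $\mathbb P_1$. Consequently, if the Planted Clique Hypothesis holds for all $0<\gamma\le1/2$, then for all $\alpha>0$ and $0<\beta<1$ such that $$\alpha<\beta<\frac12+\frac\alpha4 ,$$ there exists a sequence $\{(N_\ell,K_\ell,q_\ell)\}_{\ell\in\mathbb N}$ satisfying $\lim_{\ell\to\infty}\frac{\log\frac1{q_\ell}}{\log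 N_\ell}=\alpha$ and $\lim_{\ell\to\infty}\frac{\log K_\ell}{\log N_\ell}=\beta$ such that for any sequence of randomized polynomial-time tests $\phi_\ell:\{0,1\}^{\binom{N_\ell}{2}}\to\{0,1\}$ for $\mathsf{PDS}(N_\ell,K_\ell,2q_\ell,q_\ell)$, $$\liminf_{\ell\to\infty}\ \Big(\mathbb P_0\{\phi_\ell(G')=1\}+\mathbb P_1\{\phi_\ell(G')=0\}\Big)\ge 1,$$ where $G'\sim\mathcal G(N_\ell,q_\ell)$ under $\mathbb P_0$ and $G'\sim\mathcal G(N_\ell,K_\ell,2q_\ell,q_\ell)$ under $\mathbb P_1$.
   Context: $\mathcal G(N,q)$ is the Erdős–Rényi random graph on $N$ vertices, each pair of vertices being connected independently with probability $q$. $\mathcal G(N,K,p,q)$ (with $p>q$) is the planted dense subgraph model on $N$ vertices: each vertex is included in a random set $S$ independently with probability $K/N$; given $S$, each pair of vertices is connected independently, with probability $p$ if both vertices are in $S$ and with probability $q$ otherwise. The problem $\mathsf{PDS}(N,K,p,q)$ is to distinguish $H_0: G\sim\mathcal G(N,q)$ (law $\mathbb P_0$) from $H_1: G\sim\mathcal G(N,K,p,q)$ (law $\mathbb P_1$). A test is a $\{0,1\}$-valued (possibly randomized) function of the graph (identified with its edge indicator vector); it is polynomial-time if it is computable in time polynomial in the number of vertices. $\mathcal G(n,k,\gamma)$ is the planted clique model: draw a graph from $\mathcal G(n,\gamma)$, choose $k$ vertices uniformly at random, and add all edges among them so that they form a clique. The problem $\mathsf{PC}(n,k,\gamma)$ is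 to distinguish $H_0^{\rm C}: G\sim\mathcal G(n,\gamma)$ from $H_1^{\rm C}: G\sim\mathcal G(n,k,\gamma)$. Planted Clique Hypothesis for a constant $0<\gamma\le\frac12$: for any sequence of randomized polynomial-time tests $\{\psi_{n,k_n}\}$ (for $\mathsf{PC}(n,k_n,\gamma)$) such that $\limsup_{n\to\infty}\frac{\log k_n}{\log n}<1/2$, $$\liminf_{n\to\infty}\ \Big(\mathbb P_{H_0^{\rm C}}\{\psi_{n,k_n}(G)=1\}+\mathbb P_{H_1^{\rm C}}\{\psi_{n,k_n}(G)=0\}\Big)\ge1 .$$ *)

theory Defs
  imports "HOL-Probability.Probability" "HOL-Probability.Product_PMF"
begin

text \<open>
  A simple graph on the vertex set \<open>{..<N}\<close> is represented by its edge indicator vector, indexed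
  by the pairs \<open>(i, j)\<close> with \<open>i < j < N\<close>, and extended by \<open>False\<close> to all other pairs.
\<close>

type_synonym graph = "nat \<times> nat \<Rightarrow> bool"

definition vertex_pairs :: "nat \<Rightarrow> (nat \<times> nat) set" where
  "vertex_pairs N = {(i, j). i < j \<and> j < N}"

definition graphs :: "nat \<Rightarrow> graph set" where
  "graphs N = {G. \<forall>e. e \<notin> vertex_pairs N \<longrightarrow> \<not> G e}"

definition erdos_renyi :: "nat \<Rightarrow> real \<Rightarrow> graph pmf" where
  "erdos_renyi N q = Pi_pmf (vertex_pairs N) False (\<lambda>_. bernoulli_pmf q)"

definition random_vertex_set :: "nat \<Rightarrow> real \<Rightarrow> nat set pmf" where
  "random_vertex_set N r = map_pmf (\<lambda>f. {v. f v}) (Pi_pmf {..<N} False (\<lambda>_. bernoulli_pmf r))"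

definition planted_dense_subgraph :: "nat \<Rightarrow> nat \<Rightarrow> real \<Rightarrow> real \<Rightarrow> graph pmf" where
  "planted_dense_subgraph N K p q =
     random_vertex_set N (real K / real N) \<bind> (\<lambda>S.
       Pi_pmf (vertex_pairs N) False
         (\<lambda>(i, j). bernoulli_pmf (if i \<in> S \<and> j \<in> S then p else q)))"

definition planted_clique :: "nat \<Rightarrow> nat \<Rightarrow> real \<Rightarrow> graph pmf" where
  "planted_clique n k \<gamma> =
     erdos_renyi n \<gamma> \<bind> (\<lambda>G.
       pmf_of_set {S. S \<subseteq> {..<n} \<and> card S = k} \<bind> (\<lambda>S.
         return_pmf (\<lambda>(i, j). G (i, j) \<or> ((i, j) \<in> vertex_pairs n \<and> i \<in> S \<and> j \<in> S))))"

text \<open>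
  A randomized test maps a graph to a distribution on \<open>bool\<close>; \<open>True\<close> stands for the answer 1
  (reject the null hypothesis). The randomness of the test is independent of the graph.
\<close>

type_synonym test = "graph \<Rightarrow> bool pmf"

definition error_sum :: "graph pmf \<Rightarrow> graph pmf \<Rightarrow> test \<Rightarrow> real" where
  "error_sum H0 H1 \<phi> = pmf (H0 \<bind> \<phi>) True + pmf (H1 \<bind> \<phi>) False"

text \<open>
  The model is the random access machine with unit cost, extended by fair coin flips. Registers
  hold natural numbers, and subtraction is truncated. The only arithmetic instructions are
  increment, addition and subtraction, and no instruction loads a literal value; hence after \<open>t\<close>
  steps every register holds a number of \<open>O(t + log N)\<close> bits, and the model is polynomially
  equivalent to probabilistic Turing machines.
\<close>

datatype instr =
    Zero nat
  | Incr nat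
  | Add nat nat
  | Sub nat nat
  | Load nat nat
  | Store nat nat
  | Jump_zero nat nat
  | Flip nat

type_synonym program = "instr list"

type_synonym config = "nat \<times> (nat \<Rightarrow> nat)"

definition halted :: "program \<Rightarrow> config \<Rightarrow> bool" where
  "halted P c \<longleftrightarrow> fst c \<ge> length P"

fun exec :: "instr \<Rightarrow> config \<Rightarrow> config pmf" where
  "exec (Zero i) (pc, R) = return_pmf (Suc pc, R(i := 0))"
| "exec (Incr i) (pc, R) = return_pmf (Suc pc, R(i := R i + 1))"
| "exec (Add i j) (pc, R) = return_pmf (Suc pc, R(i := R i + R j))"
| "exec (Sub i j) (pc, R) = return_pmf (Suc pc, R(i := R i - R j))"
| "exec (Load i j) (pc, R) = return_pmf (Suc pc, R(i := R (R j)))"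
| "exec (Store i j) (pc, R) = return_pmf (Suc pc, R(R i := R j))"
| "exec (Jump_zero i l) (pc, R) = return_pmf (if R i = 0 then l else Suc pc, R)"
| "exec (Flip i) (pc, R) = map_pmf (\<lambda>b. (Suc pc, R(i := of_bool b))) (bernoulli_pmf (1/2))"

definition step :: "program \<Rightarrow> config \<Rightarrow> config pmf" where
  "step P c = (if halted P c then return_pmf c else exec (P ! fst c) c)"

primrec run :: "program \<Rightarrow> nat \<Rightarrow> config \<Rightarrow> config pmf" where
  "run P 0 c = return_pmf c"
| "run P (Suc t) c = run P t c \<bind> step P"

text \<open>
  Initially \<open>R\<^sub>0\<close> holds the number of vertices, and the registers from \<open>R\<^sub>1\<close> to \<open>R\<^sub>m\<close>, with
  \<open>m = N choose 2\<close>, hold the edge indicator vector: the pair \<open>(i, j)\<close> with \<open>i < j\<close> is stored in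
  register \<open>1 + (j choose 2) + i\<close>, which is a bijection from \<open>vertex_pairs N\<close> to \<open>{1..m}\<close>.
\<close>

definition initial_config :: "nat \<Rightarrow> graph \<Rightarrow> config" where
  "initial_config N G =
     (0, \<lambda>r. if r = 0 then N
             else of_bool (\<exists>i j. (i, j) \<in> vertex_pairs N \<and> r = 1 + (j choose 2) + i \<and> G (i, j)))"

definition computes_within :: "program \<Rightarrow> nat \<Rightarrow> nat \<Rightarrow> test \<Rightarrow> bool" where
  "computes_within P N T \<phi> \<longleftrightarrow>
     (\<forall>G \<in> graphs N.
        (\<forall>c \<in> set_pmf (run P T (initial_config N G)). halted P c) \<and>
        map_pmf (\<lambda>(pc, R). R 0 \<noteq> 0) (run P T (initial_config N G)) = \<phi> G)"

text \<open>
  A sequence of tests, the \<open>l\<close>-th one for graphs on \<open>N l\<close> vertices, is polynomial-time if one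
  polynomial in the number of vertices bounds the running times. The tests form an arbitrary
  sequence, so each index has its own program, which may depend on the parameters of the \<open>l\<close>-th
  problem (arbitrary real edge densities among them). The same polynomial therefore has to bound
  the program lengths as well: otherwise lookup tables would make every sequence of tests
  polynomial-time. A single program used for all indices is a special case.
\<close>

definition polynomial_time_tests :: "(nat \<Rightarrow> nat) \<Rightarrow> (nat \<Rightarrow> test) \<Rightarrow> bool" where
  "polynomial_time_tests N \<phi> \<longleftrightarrow>
     (\<exists>c. \<forall>l. \<exists>P. length P \<le> N l ^ c + c \<and> computes_within P (N l) (N l ^ c + c) (\<phi> l))"

definition planted_clique_hypothesis :: "real \<Rightarrow> bool" where
  "planted_clique_hypothesis \<gamma> \<longleftrightarrow>
     (\<forall>k \<psi>.
        (\<forall>n>0. 0 < k n \<and> k n \<le> n) \<longrightarrow>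
        polynomial_time_tests (\<lambda>n. n) \<psi> \<longrightarrow>
        limsup (\<lambda>n. ereal (ln (real (k n)) / ln (real n))) < ereal (1 / 2) \<longrightarrow>
        liminf (\<lambda>n. ereal (error_sum (erdos_renyi n \<gamma>) (planted_clique n (k n) \<gamma>) (\<psi> n))) \<ge> 1)"

text \<open>
  The first two conjuncts make every problem of the sequence well-defined, with \<open>q < 2 q\<close>, and the
  sequence asymptotic; in particular the quotients by \<open>ln N\<close> are eventually meaningful.
\<close>

definition pds_sequence :: "real \<Rightarrow> real \<Rightarrow> (nat \<Rightarrow> nat) \<Rightarrow> (nat \<Rightarrow> nat) \<Rightarrow> (nat \<Rightarrow> real) \<Rightarrow> bool" where
  "pds_sequence \<alpha> \<beta> N K q \<longleftrightarrow>
     (\<forall>l. 0 < K l \<and> K l \<le> N l \<and> 0 < q l \<and> 2 * q l \<le> 1) \<and>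
     filterlim N at_top sequentially \<and>
     (\<lambda>l. ln (1 / q l) / ln (real (N l))) \<longlonglongrightarrow> \<alpha> \<and>
     (\<lambda>l. ln (real (K l)) / ln (real (N l))) \<longlonglongrightarrow> \<beta>"

end

theory Submission
  imports Defs "HOL-Real_Asymp.Real_Asymp"
begin

text \<open>
  A planted clique instance on \<open>n\<close> vertices is blown up to \<open>N = n n\<^sup>a\<close> vertices: every new vertex is
  assigned to a uniformly random old vertex, and the block of pairs over an old pair \<open>st\<close> is sampled
  from \<open>P'\<close> if \<open>st\<close> is an edge and from \<open>Q'\<close> otherwise, where \<open>\<gamma> P' + (1 - \<gamma>) Q'\<close> is the product of
  Bernoulli measures with parameter \<open>q\<close> and \<open>P'\<close> is close to the one with parameter \<open>2 q\<close>. The null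
  hypothesis is then preserved exactly. Under the alternative the only remaining defect is that pairs
  inside one block have density \<open>q\<close> even in the planted set; this is invisible because the partition
  into blocks is random, by a second moment bound on the number of pairs that two independent
  partitions both collapse. Since programs may depend on the index, all the randomness of the
  reduction is replaced by advice that is at least as good as the average. Then every entry of the new
  graph is a constant, an entry of the old graph or the negation of one, and the new graph is
  computed by straight-line code that runs before the program of the given test.
\<close>

section \<open>Total variation distance and products of finite distributions\<close>

text \<open>Two error terms fix the range of \<open>\<beta>\<close>. On a block over an edge, the
  mixture yields density \<open>2 * q\<close> exactly where the likelihood ratio of the two products
  is at most \<open>1 / \<gamma>\<close>. A present pair contributes a factor 2, an absent one less
  than 1, so with \<open>\<gamma> * 2 ^ m \<le> 1\<close> the ratio is exceeded only if more than
  \<open>m\<close> pairs are present. With at most \<open>L\<close> vertices per block, a clique of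
  size \<open>k\<close> costs at most \<open>k\<^sup>2 * (2 * q * L\<^sup>2) ^ Suc m\<close>. For
  \<open>k\<close> near \<open>n powr c\<close>, \<open>L\<close> near \<open>n powr a\<close> and
  \<open>q\<close> near \<open>N powr (- \<alpha>)\<close>, this vanishes if
  \<open>2 * c < Suc m * s\<close>, where \<open>s = \<alpha> * (1 + a) - 2 * a\<close>. Pairs
  inside blocks resist this argument: for a fixed partition the missing edges number about
  \<open>q * k * L\<^sup>2\<close>, possibly many. But of the \<open>k * L\<^sup>2\<close> planted
  pairs that one partition collapses, an independent partition collapses a fraction
  \<open>1 / k\<close>. The second moment therefore depends on \<open>q * L\<^sup>2\<close> only,
  and \<open>s > 0\<close> suffices. Together with \<open>c < 1 / 2\<close>, demanded by the
  hypothesis, and \<open>\<beta> = (c + a) / (1 + a)\<close>, these are all the constraints on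
  \<open>a\<close> and \<open>c\<close>.\<close>

abbreviation expect :: "'a pmf \<Rightarrow> ('a \<Rightarrow> real) \<Rightarrow> real" where
  "expect p \<equiv> measure_pmf.expectation p"

lemma integrable_unit:
  assumes "\<And>x. 0 \<le> h x \<and> h x \<le> (1::real)" shows "integrable (measure_pmf p) h"
  using assms by (intro measure_pmf.integrable_const_bound[where B = 1]) (auto simp: abs_le_iff intro: order_trans[of _ 0])

lemma expect_unit:
  assumes "\<And>x. 0 \<le> h x \<and> h x \<le> (1::real)" shows "0 \<le> expect p h" "expect p h \<le> 1"
proof -
  show "0 \<le> expect p h" using assms by (intro integral_nonneg_AE) auto
  have "expect p h \<le> expect p (\<lambda>_. 1)"
    using assms by (intro integral_mono integrable_unit) auto
  then show "expect p h \<le> 1" by simp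
qed

text \<open>Boundedness replaces finiteness of the supports: both sides agree as nonnegative
  integrals. \<open>expect_bind_finite\<close> is the counterpart for unbounded integrands.\<close>

lemma expect_bind:
  fixes f :: "'a \<Rightarrow> 'b pmf"
  assumes h: "\<And>x. 0 \<le> h x \<and> h x \<le> (1::real)"
  shows "expect (p \<bind> f) h = expect p (\<lambda>x. expect (f x) h)"
proof -
  have eq: "ennreal (expect r g) = (\<integral>\<^sup>+x. ennreal (g x) \<partial>measure_pmf r)"
    if "\<And>x. 0 \<le> g x \<and> g x \<le> 1" for r :: "'z pmf" and g
    using that by (subst nn_integral_eq_integral) (auto intro: integrable_unit)
  have "ennreal (expect (p \<bind> f) h) = ennreal (expect p (\<lambda>x. expect (f x) h))"
    by (subst (1 2) eq) (auto simp: h expect_unit[OF h] eq[OF h])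
  moreover have "0 \<le> expect p (\<lambda>x. expect (f x) h)"
    using expect_unit[OF h] by (intro expect_unit) auto
  moreover have "0 \<le> expect (p \<bind> f) h" by (rule expect_unit(1)[OF h])
  ultimately show ?thesis by (simp add: ennreal_inj)
qed

text \<open>Total variation distance at most \<open>d\<close>, in its dual form.\<close>

definition tv_le :: "'a pmf \<Rightarrow> 'a pmf \<Rightarrow> real \<Rightarrow> bool" where
  "tv_le p q d \<longleftrightarrow> (\<forall>h. (\<forall>x. 0 \<le> h x \<and> h x \<le> 1) \<longrightarrow> expect p h \<le> expect q h + d)"

lemma tv_leI:
  "(\<And>h. (\<And>x. 0 \<le> h x \<and> h x \<le> 1) \<Longrightarrow> expect p h \<le> expect q h + d) \<Longrightarrow> tv_le p q d"
  by (auto simp: tv_le_def)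

lemma tv_leD:
  "tv_le p q d \<Longrightarrow> (\<And>x. 0 \<le> h x \<and> h x \<le> 1) \<Longrightarrow> expect p h \<le> expect q h + d"
  by (auto simp: tv_le_def)

lemma tv_le_refl: "tv_le p p 0"
  by (simp add: tv_le_def)

lemma tv_le_mono: "tv_le p q d \<Longrightarrow> d \<le> e \<Longrightarrow> tv_le p q e"
  unfolding tv_le_def by (meson add_left_mono order_trans)

lemma tv_le_trans:
  assumes "tv_le p q d" "tv_le q r e" shows "tv_le p r (d + e)"
proof (rule tv_leI)
  fix h :: "'a \<Rightarrow> real" assume h: "\<And>x. 0 \<le> h x \<and> h x \<le> 1"
  show "expect p h \<le> expect r h + (d + e)"
    using tv_leD[OF assms(1), of h] tv_leD[OF assms(2), of h] h by fastforce
qed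

lemma tv_le_one: "tv_le p q 1"
proof (rule tv_leI)
  fix h :: "'a \<Rightarrow> real" assume h: "\<And>x. 0 \<le> h x \<and> h x \<le> 1"
  show "expect p h \<le> expect q h + 1"
    using expect_unit(2)[of h p] expect_unit(1)[of h q] h by fastforce
qed

text \<open>Passing from \<open>h\<close> to \<open>1 - h\<close> reverses the one-sided
  bound.\<close>

lemma tv_le_sym:
  assumes "tv_le p q d" shows "tv_le q p d"
proof (rule tv_leI)
  fix h :: "'a \<Rightarrow> real" assume h: "\<And>x. 0 \<le> h x \<and> h x \<le> 1"
  have "expect r (\<lambda>x. 1 - h x) = 1 - expect r h" for r
    by (subst Bochner_Integration.integral_diff) (auto intro: integrable_unit[OF h])
  with tv_leD[OF assms, of "\<lambda>x. 1 - h x"] h show "expect q h \<le> expect p h + d" by simp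
qed

lemma tv_le_bind_left:
  fixes F :: "'a \<Rightarrow> 'b pmf"
  shows "tv_le p q d \<Longrightarrow> tv_le (p \<bind> F) (q \<bind> F) d"
  by (rule tv_leI) (auto simp: expect_bind expect_unit intro: tv_leD)

lemma tv_le_map: "tv_le p q d \<Longrightarrow> tv_le (map_pmf f p) (map_pmf f q) d"
  unfolding map_pmf_def by (rule tv_le_bind_left)

text \<open>The cost \<open>d\<close> is averaged, not maximised, so that rare outcomes such as
  overloaded partitions can be charged the trivial distance 1.\<close>

lemma tv_le_bind:
  fixes F G :: "'a \<Rightarrow> 'b pmf"
  assumes "\<And>x. x \<in> set_pmf p \<Longrightarrow> tv_le (F x) (G x) (d x)" "finite (set_pmf p)"
  shows "tv_le (p \<bind> F) (p \<bind> G) (expect p d)"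
proof (rule tv_leI)
  fix h :: "'b \<Rightarrow> real" assume h: "\<And>x. 0 \<le> h x \<and> h x \<le> 1"
  have "expect p (\<lambda>x. expect (F x) h) \<le> expect p (\<lambda>x. expect (G x) h + d x)"
    using assms h
    by (intro integral_mono_AE integrable_measure_pmf_finite) (auto simp: AE_measure_pmf_iff tv_leD)
  also have "\<dots> = expect p (\<lambda>x. expect (G x) h) + expect p d"
    using assms(2) by (intro Bochner_Integration.integral_add integrable_measure_pmf_finite)
  finally show "expect (p \<bind> F) h \<le> expect (p \<bind> G) h + expect p d"
    by (simp add: expect_bind[OF h])
qed

lemma tv_le_bind_const:
  fixes F G :: "'a \<Rightarrow> 'b pmf"
  assumes "\<And>x. x \<in> set_pmf p \<Longrightarrow> tv_le (F x) (G x) d" "finite (set_pmf p)"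
  shows "tv_le (p \<bind> F) (p \<bind> G) d"
  using tv_le_bind[of p F G "\<lambda>_. d"] assms by simp

text \<open>Hybrid argument: the coordinates are exchanged one at a time and the triangle inequality
  adds up the costs.\<close>

lemma tv_le_Pi_pmf:
  assumes "finite A" "\<And>x. x \<in> A \<Longrightarrow> tv_le (p x) (q x) (d x)"
    and "\<And>x. x \<in> A \<Longrightarrow> finite (set_pmf (p x)) \<and> finite (set_pmf (q x))"
  shows "tv_le (Pi_pmf A dflt p) (Pi_pmf A dflt q) (\<Sum>x\<in>A. d x)"
  using assms
proof (induction A)
  case (insert x A)
  have "tv_le (p x \<bind> (\<lambda>y. Pi_pmf A dflt p \<bind> (\<lambda>f. return_pmf (f(x := y)))))
    (p x \<bind> (\<lambda>y. Pi_pmf A dflt q \<bind> (\<lambda>f. return_pmf (f(x := y))))) (\<Sum>x\<in>A. d x)"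
    using insert by (intro tv_le_bind_const tv_le_bind_left) auto
  moreover have "tv_le (p x \<bind> (\<lambda>y. Pi_pmf A dflt q \<bind> (\<lambda>f. return_pmf (f(x := y)))))
    (q x \<bind> (\<lambda>y. Pi_pmf A dflt q \<bind> (\<lambda>f. return_pmf (f(x := y))))) (d x)"
    using insert by (intro tv_le_bind_left) auto
  ultimately have "tv_le (p x \<bind> (\<lambda>y. Pi_pmf A dflt p \<bind> (\<lambda>f. return_pmf (f(x := y)))))
    (q x \<bind> (\<lambda>y. Pi_pmf A dflt q \<bind> (\<lambda>f. return_pmf (f(x := y))))) ((\<Sum>x\<in>A. d x) + d x)"
    by (rule tv_le_trans)
  with insert show ?case by (simp add: Pi_pmf_insert' add.commute)
qed (simp add: tv_le_refl)

lemma finite_set_Pi_pmf: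
  assumes "finite A" "\<And>x. x \<in> A \<Longrightarrow> finite (set_pmf (p x))"
  shows "finite (set_pmf (Pi_pmf A dflt p))"
  using assms by (simp add: set_Pi_pmf finite_PiE_dflt)

lemma expect_swap:
  fixes g :: "'a \<Rightarrow> 'b \<Rightarrow> real"
  assumes p: "finite (set_pmf p)" and q: "finite (set_pmf q)"
  shows "expect p (\<lambda>x. expect q (\<lambda>y. g x y)) = expect q (\<lambda>y. expect p (\<lambda>x. g x y))"
proof -
  have "expect p f = (\<Sum>x\<in>set_pmf p. f x * pmf p x)" for f
    using p by (intro integral_measure_pmf_real) auto
  moreover have "expect q f = (\<Sum>x\<in>set_pmf q. f x * pmf q x)" for f
    using q by (intro integral_measure_pmf_real) auto
  ultimately show ?thesis
    by (simp only: sum_distrib_right) (subst sum.swap, simp add: mult_ac)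
qed

lemma expect_attained:
  assumes "finite (set_pmf p)"
  obtains x where "x \<in> set_pmf p" "g x \<le> expect p g"
proof -
  let ?m = "Min (g ` set_pmf p)"
  have "?m \<in> g ` set_pmf p" using assms set_pmf_not_empty by (intro Min_in) auto
  then obtain x where x: "x \<in> set_pmf p" "g x = ?m" by auto
  have "expect p (\<lambda>_. ?m) \<le> expect p g"
    using assms by (intro integral_mono_AE integrable_measure_pmf_finite) (auto simp: AE_measure_pmf_iff)
  with x that show thesis by simp
qed

lemma prob_eq_expect: "measure_pmf.prob p A = expect p (\<lambda>x. of_bool (x \<in> A))"
proof -
  have "expect p (indicator A) = measure_pmf.prob p A" by simp
  moreover have "(indicator A :: _ \<Rightarrow> real) = (\<lambda>x. of_bool (x \<in> A))" by (auto simp: indicator_def)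
  ultimately show ?thesis by simp
qed

lemma pmf_of_finite_sum:
  assumes "finite A" "\<And>x. 0 \<le> f x" "\<And>x. x \<notin> A \<Longrightarrow> f x = 0" "(\<Sum>x\<in>A. f x) = 1"
  obtains p where "\<And>x. pmf p x = f x"
proof -
  have "(\<integral>\<^sup>+x. ennreal (f x) \<partial>count_space UNIV) = (\<Sum>x\<in>A. ennreal (f x))"
    using assms by (intro nn_integral_count_space') auto
  also have "\<dots> = 1" using assms by (simp add: sum_ennreal)
  finally show thesis using assms that[of "embed_pmf f"] by (simp add: pmf_embed_pmf)
qed

text \<open>
  The witness is \<open>P' = c + \<theta> (Q / \<gamma> - c)\<close> with \<open>c = min P (Q / \<gamma>)\<close>: the mass that \<open>c\<close> misses
  fits below \<open>Q / \<gamma>\<close>, because \<open>Q / \<gamma>\<close> has total mass at least \<open>1\<close>.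
\<close>

lemma mixture_decomposition:
  fixes P Q :: "'a pmf"
  assumes \<gamma>: "0 < \<gamma>" "\<gamma> < 1" and fin: "finite (set_pmf P)" "finite (set_pmf Q)"
  obtains P' Q' where "bernoulli_pmf \<gamma> \<bind> (\<lambda>b. if b then P' else Q') = Q"
    "tv_le P' P (measure_pmf.prob P {x. pmf Q x < \<gamma> * pmf P x})"
    "set_pmf P' \<subseteq> set_pmf Q" "set_pmf Q' \<subseteq> set_pmf Q"
proof -
  define A where "A = set_pmf P \<union> set_pmf Q"
  have A: "finite A" using fin by (simp add: A_def)
  have sums: "sum (pmf P) A = 1" "sum (pmf Q) A = 1"
    using A by (auto intro!: sum_pmf_eq_1 simp: A_def)
  define c where "c x = min (pmf P x) (pmf Q x / \<gamma>)" for x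
  define \<delta> where "\<delta> = 1 - sum c A"
  have c: "0 \<le> c x" "c x \<le> pmf P x" "c x \<le> pmf Q x / \<gamma>" for x using \<gamma> by (auto simp: c_def)
  have "sum c A \<le> sum (pmf P) A" by (intro sum_mono c)
  then have \<delta>0: "0 \<le> \<delta>" using sums by (simp add: \<delta>_def)
  \<comment> \<open>\<open>D\<close> is the total mass of \<open>Q / \<gamma> - c\<close>, positive
    because \<open>\<gamma> < 1\<close>; \<open>\<theta>\<close> is the fraction of it that makes up
    for the mass \<open>\<delta>\<close> missing from \<open>c\<close>.\<close>
  define D where "D = 1 / \<gamma> - 1 + \<delta>"
  have "1 / \<gamma> - 1 > 0" using \<gamma> by simp
  then have D: "D > 0" "\<delta> \<le> D" using \<delta>0 by (auto simp: D_def)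
  define \<theta> where "\<theta> = \<delta> / D"
  have \<theta>: "0 \<le> \<theta>" "\<theta> \<le> 1" using D \<delta>0 by (auto simp: \<theta>_def)
  define p' where "p' x = c x + \<theta> * (pmf Q x / \<gamma> - c x)" for x
  have p'c: "c x \<le> p' x" for x using \<theta> c by (simp add: p'_def)
  have p'0: "0 \<le> p' x" for x using order_trans[OF c(1) p'c] .
  have p'Q: "\<gamma> * p' x \<le> pmf Q x" for x
  proof -
    have "p' x \<le> c x + 1 * (pmf Q x / \<gamma> - c x)"
      unfolding p'_def using \<theta> c by (intro add_left_mono mult_right_mono) auto
    then show ?thesis using \<gamma> by (simp add: field_simps)
  qed
  have "sum p' A = sum c A + \<theta> * (1 / \<gamma> - sum c A)"
    by (simp add: p'_def sum.distrib sum_distrib_left[symmetric] sum_subtractf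
        sum_divide_distrib[symmetric] sums)
  also have "\<dots> = 1" using D by (simp add: \<theta>_def \<delta>_def D_def)
  finally have p'1: "sum p' A = 1" .
  have p'out: "p' x = 0" if "pmf Q x = 0" for x
    using p'Q[of x] p'0[of x] \<gamma> that by (simp add: mult_le_0_iff)
  obtain P' where P': "\<And>x. pmf P' x = p' x"
    using pmf_of_finite_sum[OF A p'0 _ p'1] p'out by (metis A_def UnI2 set_pmf_iff)
  define q' where "q' x = (pmf Q x - \<gamma> * p' x) / (1 - \<gamma>)" for x
  have q'0: "0 \<le> q' x" for x using p'Q \<gamma> by (simp add: q'_def)
  have q'1: "sum q' A = 1"
    using \<gamma> by (simp add: q'_def sum_divide_distrib[symmetric] sum_subtractf
        sum_distrib_left[symmetric] sums p'1)
  have q'out: "q' x = 0" if "pmf Q x = 0" for x using p'out that by (simp add: q'_def)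
  obtain Q' where Q': "\<And>x. pmf Q' x = q' x"
    using pmf_of_finite_sum[OF A q'0 _ q'1] q'out by (metis A_def UnI2 set_pmf_iff)
  have "bernoulli_pmf \<gamma> \<bind> (\<lambda>b. if b then P' else Q') = Q"
  proof (rule pmf_eqI)
    fix x
    show "pmf (bernoulli_pmf \<gamma> \<bind> (\<lambda>b. if b then P' else Q')) x = pmf Q x"
      using \<gamma> by (simp add: pmf_bind P' Q' q'_def)
  qed
  moreover have "tv_le P' P (measure_pmf.prob P {x. pmf Q x < \<gamma> * pmf P x})"
  \<comment> \<open>The reversed direction is pointwise: outside \<open>?B\<close> the minimum
    \<open>c\<close> equals \<open>P\<close>, so \<open>P'\<close> dominates \<open>P\<close> there,
    and on \<open>?B\<close> the whole mass of \<open>P\<close> is given away.\<close>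
  proof (rule tv_le_sym, rule tv_leI)
    fix h :: "'a \<Rightarrow> real" assume h: "\<And>x. 0 \<le> h x \<and> h x \<le> 1"
    let ?B = "{x. pmf Q x < \<gamma> * pmf P x}"
    have P_sum: "expect P g = (\<Sum>x\<in>A. g x * pmf P x)" for g
      by (rule integral_measure_pmf_real[OF A]) (auto simp: A_def)
    have P'_sum: "expect P' g = (\<Sum>x\<in>A. g x * p' x)" for g
      unfolding P'[symmetric] using p'out
      by (intro integral_measure_pmf_real[OF A]) (auto simp: A_def set_pmf_iff P')
    have "h x * pmf P x \<le> h x * p' x + of_bool (x \<in> ?B) * pmf P x" for x
    proof (cases "x \<in> ?B")
      case True
      then show ?thesis using h[of x] p'0[of x] mult_right_mono[of "h x" 1 "pmf P x"]
        by (simp add: add_increasing)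
    next
      case False
      then have "pmf P x \<le> p' x" using p'c[of x] \<gamma> by (auto simp: c_def field_simps min_def split: if_splits)
      then show ?thesis using h[of x] False by (simp add: mult_left_mono)
    qed
    then have "(\<Sum>x\<in>A. h x * pmf P x) \<le> (\<Sum>x\<in>A. h x * p' x + of_bool (x \<in> ?B) * pmf P x)"
      by (intro sum_mono)
    then show "expect P h \<le> expect P' h + measure_pmf.prob P ?B"
      by (simp add: prob_eq_expect P_sum P'_sum sum.distrib)
  qed
  moreover have "set_pmf P' \<subseteq> set_pmf Q" "set_pmf Q' \<subseteq> set_pmf Q"
    using p'out q'out by (auto simp: set_pmf_iff P' Q')
  ultimately show thesis using that by blast
qed

section \<open>Independent coordinates: regrouping, change of measure, second moments\<close>

lemma Pi_pmf_map_dependent: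
  assumes "finite A"
  shows "Pi_pmf A d (\<lambda>x. map_pmf (h x) (p x)) =
    map_pmf (\<lambda>f x. if x \<in> A then h x (f x) else d) (Pi_pmf A d' p)"
  using assms by (simp add: map_pmf_def Pi_pmf_bind[where d' = d'])

text \<open>Independent entries may be drawn group by group, one group for each value of
  \<open>idx\<close>. With \<open>idx = block_of f\<close> a random graph is drawn block by
  block.\<close>

lemma Pi_pmf_fibres:
  assumes "finite I" "finite A"
  shows "Pi_pmf {e \<in> A. idx e \<in> I} d p =
    map_pmf (\<lambda>H e. if e \<in> A \<and> idx e \<in> I then H (idx e) e else d)
      (Pi_pmf I d' (\<lambda>i. Pi_pmf {e \<in> A. idx e = i} d p))"
  using assms(1)
proof (induction I)
  case (insert i I)
  let ?X = "Pi_pmf I d' (\<lambda>i. Pi_pmf {e \<in> A. idx e = i} d p)"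
  have split: "{e \<in> A. idx e \<in> insert i I} = {e \<in> A. idx e = i} \<union> {e \<in> A. idx e \<in> I}" by auto
  have "Pi_pmf {e \<in> A. idx e \<in> insert i I} d p =
    map_pmf (\<lambda>(f, g) x. if x \<in> {e \<in> A. idx e = i} then f x else g x)
      (pair_pmf (Pi_pmf {e \<in> A. idx e = i} d p) (Pi_pmf {e \<in> A. idx e \<in> I} d p))"
    unfolding split using assms insert.hyps by (intro Pi_pmf_union) auto
  also have "\<dots> = map_pmf (\<lambda>(f, H) x. if x \<in> {e \<in> A. idx e = i} then f x
        else if x \<in> A \<and> idx x \<in> I then H (idx x) x else d)
      (pair_pmf (Pi_pmf {e \<in> A. idx e = i} d p) ?X)"
    unfolding insert.IH pair_map_pmf2 pmf.map_comp
    by (intro map_pmf_cong refl) (auto simp: fun_eq_iff)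
  also have "\<dots> = map_pmf (\<lambda>H e. if e \<in> A \<and> idx e \<in> insert i I then H (idx e) e else d)
      (Pi_pmf (insert i I) d' (\<lambda>i. Pi_pmf {e \<in> A. idx e = i} d p))"
    using insert.hyps unfolding Pi_pmf_insert[OF insert.hyps] pmf.map_comp
    by (intro map_pmf_cong refl) (auto simp: fun_eq_iff)
  finally show ?case .
qed simp

text \<open>\<open>r\<close> is the likelihood ratio of a single coordinate, so by independence the
  product of the ratios is the density of one product measure relative to the other.\<close>

lemma expect_change_of_measure:
  assumes A: "finite A" and fin: "\<And>e. e \<in> A \<Longrightarrow> finite (set_pmf (p e))"
    and r: "\<And>e v. e \<in> A \<Longrightarrow> pmf (p e) v * r e v = pmf (p' e) v"
  shows "expect (Pi_pmf A d p) (\<lambda>y. (\<Prod>e\<in>A. r e (y e)) * h y) = expect (Pi_pmf A d p') h"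
proof -
  let ?S = "set_pmf (Pi_pmf A d p)"
  have S: "finite ?S" using A fin by (rule finite_set_Pi_pmf)
  have sub: "set_pmf (Pi_pmf A d p') \<subseteq> ?S"
    using A r[symmetric] by (auto simp: set_Pi_pmf PiE_dflt_def set_pmf_iff)
  have eq: "(\<Prod>e\<in>A. r e (y e)) * pmf (Pi_pmf A d p) y = pmf (Pi_pmf A d p') y" for y
  proof -
    have "(\<Prod>e\<in>A. r e (y e) * pmf (p e) (y e)) = (\<Prod>e\<in>A. pmf (p' e) (y e))"
      by (intro prod.cong) (auto simp: r[symmetric] mult.commute)
    then show ?thesis using A by (auto simp: pmf_Pi prod.distrib[symmetric])
  qed
  have "expect (Pi_pmf A d p) (\<lambda>y. (\<Prod>e\<in>A. r e (y e)) * h y)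
    = (\<Sum>y\<in>?S. h y * ((\<Prod>e\<in>A. r e (y e)) * pmf (Pi_pmf A d p) y))"
    by (subst integral_measure_pmf_real[OF S]) (auto simp: mult_ac)
  also have "\<dots> = expect (Pi_pmf A d p') h"
    unfolding eq by (rule integral_measure_pmf_real[OF S, symmetric]) (use sub in auto)
  finally show ?thesis .
qed

text \<open>
  The second moment is only taken on the event \<open>good\<close>; the linear bound
  \<open>\<bar>w - 1\<bar> \<le> ((w - 1)\<^sup>2 / t + t) / 2\<close> replaces Cauchy--Schwarz, so that the result
  can be averaged over further randomness.
\<close>

lemma second_moment_tv:
  fixes \<kappa> :: "'f pmf" and \<mu> :: "'f \<Rightarrow> 'a pmf" and \<nu> :: "'a pmf" and \<Lambda> :: "'f \<Rightarrow> 'a \<Rightarrow> real"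
  assumes fin: "finite (set_pmf \<kappa>)" "finite (set_pmf \<nu>)"
    and \<Lambda>: "\<And>f h. f \<in> set_pmf \<kappa> \<Longrightarrow> expect \<nu> (\<lambda>x. \<Lambda> f x * h x) = expect (\<mu> f) h"
    and \<Lambda>0: "\<And>f x. 0 \<le> \<Lambda> f x"
    and moment: "\<And>f'. f' \<in> set_pmf \<kappa> \<Longrightarrow> good f' \<Longrightarrow>
      expect \<kappa> (\<lambda>f. expect \<nu> (\<lambda>x. \<Lambda> f x * \<Lambda> f' x)) \<le> 1 + \<epsilon>"
    and \<epsilon>: "0 \<le> \<epsilon>" and t: "0 < t"
  shows "tv_le (\<kappa> \<bind> \<mu>) \<nu>
    (measure_pmf.prob \<kappa> {f. \<not> good f} + ((\<epsilon> + 2 * measure_pmf.prob \<kappa> {f. \<not> good f}) / t + t) / 2)"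
proof (rule tv_leI)
  fix h :: "'a \<Rightarrow> real" assume h: "\<And>x. 0 \<le> h x \<and> h x \<le> 1"
  define \<beta> where "\<beta> = measure_pmf.prob \<kappa> {f. \<not> good f}"
  define g where "g f = (of_bool (good f) :: real)" for f
  \<comment> \<open>\<open>w\<close> is the density, relative to \<open>\<nu>\<close>, of the part
    of the mixture that comes from good \<open>f\<close>.\<close>
  define w where "w x = expect \<kappa> (\<lambda>f. g f * \<Lambda> f x)" for x
  note [simp] = integrable_measure_pmf_finite[OF fin(1)] integrable_measure_pmf_finite[OF fin(2)]
  note swap = expect_swap[OF fin]
  have g: "expect \<kappa> g = 1 - \<beta>"
  proof -
    have "\<beta> = expect \<kappa> (\<lambda>f. 1 - g f)" unfolding \<beta>_def prob_eq_expect g_def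
      by (intro Bochner_Integration.integral_cong) auto
    also have "\<dots> = 1 - expect \<kappa> g" by simp
    finally show ?thesis by simp
  qed
  have wh: "expect \<nu> (\<lambda>x. w x * h x) = expect \<kappa> (\<lambda>f. g f * expect (\<mu> f) h)" for h
  proof -
    have "expect \<nu> (\<lambda>x. w x * h x) = expect \<nu> (\<lambda>x. expect \<kappa> (\<lambda>f. g f * (\<Lambda> f x * h x)))"
      unfolding w_def by (simp only: integral_mult_left_zero[symmetric] mult.assoc)
    also have "\<dots> = expect \<kappa> (\<lambda>f. g f * expect \<nu> (\<lambda>x. \<Lambda> f x * h x))"
      by (subst swap[symmetric]) simp
    also have "\<dots> = expect \<kappa> (\<lambda>f. g f * expect (\<mu> f) h)"
      by (intro integral_cong_AE) (auto simp: AE_measure_pmf_iff \<Lambda>)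
    finally show ?thesis .
  qed
  have w1: "expect \<nu> w = 1 - \<beta>" using wh[of "\<lambda>_. 1"] g by simp
  \<comment> \<open>The square is expanded into two independent copies \<open>f\<close> and
    \<open>f'\<close>. The indicator of \<open>f'\<close> gives access to \<open>moment\<close>;
    that of \<open>f\<close> is then dropped because \<open>\<Lambda>\<close> is
    nonnegative.\<close>
  have "expect \<nu> (\<lambda>x. w x * w x) = expect \<kappa> (\<lambda>f'. expect \<nu> (\<lambda>x. g f' * (\<Lambda> f' x * w x)))"
    unfolding swap by (intro Bochner_Integration.integral_cong refl)
      (simp add: w_def mult.assoc integral_mult_left_zero[symmetric] del: integral_mult_left_zero integral_mult_right_zero integral_mult_left integral_mult_right)
  also have "\<dots> \<le> expect \<kappa> (\<lambda>f'. 1 + \<epsilon>)"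
  proof (rule integral_mono_AE)
    have "expect \<nu> (\<lambda>x. g f' * (\<Lambda> f' x * w x)) \<le> 1 + \<epsilon>" if f': "f' \<in> set_pmf \<kappa>" for f'
    proof (cases "good f'")
      case True
      have "expect \<nu> (\<lambda>x. g f' * (\<Lambda> f' x * w x)) = expect \<nu> (\<lambda>x. expect \<kappa> (\<lambda>f. g f * (\<Lambda> f x * \<Lambda> f' x)))"
        using True unfolding w_def integral_mult_right_zero[symmetric]
        by (simp add: g_def mult_ac)
      also have "\<dots> = expect \<kappa> (\<lambda>f. expect \<nu> (\<lambda>x. g f * (\<Lambda> f x * \<Lambda> f' x)))" by (rule swap[symmetric])
      also have "\<dots> \<le> expect \<kappa> (\<lambda>f. expect \<nu> (\<lambda>x. \<Lambda> f x * \<Lambda> f' x))"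
        using \<Lambda>0 by (intro integral_mono) (auto simp: g_def)
      also have "\<dots> \<le> 1 + \<epsilon>" using moment[OF f' True] .
      finally show ?thesis .
    next
      case False
      then show ?thesis using \<epsilon> by (simp add: g_def)
    qed
    then show "AE f' in measure_pmf \<kappa>. expect \<nu> (\<lambda>x. g f' * (\<Lambda> f' x * w x)) \<le> 1 + \<epsilon>"
      by (simp add: AE_measure_pmf_iff)
  qed auto
  finally have w2: "expect \<nu> (\<lambda>x. w x * w x) \<le> 1 + \<epsilon>" by simp
  have "expect \<nu> (\<lambda>x. (w x - 1)\<^sup>2) = expect \<nu> (\<lambda>x. w x * w x - 2 * w x + 1)"
    by (intro Bochner_Integration.integral_cong) (auto simp: power2_eq_square algebra_simps)
  also have "\<dots> = expect \<nu> (\<lambda>x. w x * w x) - 2 * expect \<nu> w + 1" by simp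
  also have "\<dots> \<le> \<epsilon> + 2 * \<beta>" using w1 w2 by simp
  finally have var: "expect \<nu> (\<lambda>x. (w x - 1)\<^sup>2) \<le> \<epsilon> + 2 * \<beta>" .
  have "expect \<nu> (\<lambda>x. w x * h x) \<le> expect \<nu> (\<lambda>x. h x + ((w x - 1)\<^sup>2 / t + t) / 2)"
  proof (intro integral_mono)
    fix x
    have "0 \<le> (\<bar>w x - 1\<bar> - t)\<^sup>2" by simp
    then have "2 * \<bar>w x - 1\<bar> * t \<le> (w x - 1)\<^sup>2 + t * t"
      by (simp add: power2_diff) (simp add: power2_eq_square)
    then have "\<bar>w x - 1\<bar> \<le> ((w x - 1)\<^sup>2 / t + t) / 2" using t by (simp add: field_simps)
    moreover have "(w x - 1) * h x \<le> \<bar>w x - 1\<bar>"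
      using h[of x] by (metis abs_ge_self abs_ge_zero abs_mult abs_of_nonneg mult_left_le order_trans)
    moreover have "w x * h x = h x + (w x - 1) * h x" by (simp add: algebra_simps)
    ultimately show "w x * h x \<le> h x + ((w x - 1)\<^sup>2 / t + t) / 2" by linarith
  qed auto
  also have "\<dots> = expect \<nu> h + (expect \<nu> (\<lambda>x. (w x - 1)\<^sup>2) / t + t) / 2" by simp
  also have "\<dots> \<le> expect \<nu> h + ((\<epsilon> + 2 * \<beta>) / t + t) / 2"
    using var t by (simp add: divide_right_mono)
  finally have main: "expect \<kappa> (\<lambda>f. g f * expect (\<mu> f) h) \<le> expect \<nu> h + ((\<epsilon> + 2 * \<beta>) / t + t) / 2"
    by (simp add: wh)
  have "expect \<kappa> (\<lambda>f. expect (\<mu> f) h) \<le> expect \<kappa> (\<lambda>f. g f * expect (\<mu> f) h + (1 - g f))"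
    using expect_unit[OF h] by (intro integral_mono) (auto simp: g_def)
  also have "\<dots> = expect \<kappa> (\<lambda>f. g f * expect (\<mu> f) h) + \<beta>" using g by simp
  finally show "expect (\<kappa> \<bind> \<mu>) h \<le> expect \<nu> h +
    (measure_pmf.prob \<kappa> {f. \<not> good f} + ((\<epsilon> + 2 * measure_pmf.prob \<kappa> {f. \<not> good f}) / t + t) / 2)"
    using main by (simp add: expect_bind[OF h] \<beta>_def)
qed


section \<open>Graph rewriting on the random access machine\<close>

text \<open>Register numbers are hard-wired, since every index has its own program. So no indirect
  access, jump or coin flip occurs, and \<open>effect\<close> describes a deterministic map.\<close>

fun straight :: "instr \<Rightarrow> bool" where
  "straight (Zero i) = True"
| "straight (Incr i) = True"
| "straight (Add i j) = True"
| "straight (Sub i j) = True"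
| "straight _ = False"

fun effect :: "instr \<Rightarrow> (nat \<Rightarrow> nat) \<Rightarrow> nat \<Rightarrow> nat" where
  "effect (Zero i) R = R(i := 0)"
| "effect (Incr i) R = R(i := R i + 1)"
| "effect (Add i j) R = R(i := R i + R j)"
| "effect (Sub i j) R = R(i := R i - R j)"
| "effect _ R = R"

lemma exec_straight: "straight x \<Longrightarrow> exec x (pc, R) = return_pmf (Suc pc, effect x R)"
  by (cases x) auto

lemma run_add: "run P (s + t) c = run P s c \<bind> run P t"
proof (induction t)
  case 0
  have "run P 0 = return_pmf" by (rule ext) simp
  then show ?case by (simp add: bind_return_pmf')
next
  case (Suc t)
  have "run P (Suc t) = (\<lambda>c. run P t c \<bind> step P)" by (rule ext) simp
  with Suc show ?case by (simp add: bind_assoc_pmf)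
qed

lemma run_halted: "halted P c \<Longrightarrow> run P t c = return_pmf c"
  by (induction t) (auto simp: bind_return_pmf step_def)

lemma run_straight:
  assumes "\<forall>x\<in>set xs. straight x" "t \<le> length xs"
  shows "run (xs @ ys) t (0, R) = return_pmf (t, fold effect (take t xs) R)"
  using assms(2)
proof (induction t)
  case (Suc t)
  then have "straight (xs ! t)" using assms(1) by auto
  with Suc show ?case
    by (simp add: bind_return_pmf step_def halted_def nth_append exec_straight
        take_Suc_conv_app_nth)
qed simp

text \<open>Jump targets are absolute positions, hence they move when code is put in front.\<close>

fun shift_jump :: "nat \<Rightarrow> instr \<Rightarrow> instr" where
  "shift_jump d (Jump_zero i l) = Jump_zero i (d + l)"
| "shift_jump d x = x"

lemma exec_shift_jump:
  "exec (shift_jump d x) (d + pc, R) = map_pmf (apfst ((+) d)) (exec x (pc, R))"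
  by (cases x) (auto simp: pmf.map_comp o_def)

text \<open>Step-by-step simulation, halting included: all shifted targets lie behind the prefix, so
  it is never entered again.\<close>

lemma run_shift_jump:
  "run (xs @ map (shift_jump (length xs)) P) t (apfst ((+) (length xs)) c)
     = map_pmf (apfst ((+) (length xs))) (run P t c)"
proof (induction t)
  case (Suc t)
  let ?d = "length xs"
  have "step (xs @ map (shift_jump ?d) P) (apfst ((+) ?d) c) = map_pmf (apfst ((+) ?d)) (step P c)" for c
    by (cases c) (auto simp: step_def halted_def nth_append exec_shift_jump)
  with Suc show ?case by (simp add: bind_map_pmf map_bind_pmf)
qed simp

text \<open>The right-hand sides read only registers that are never assigned, so the sequence acts
  like one simultaneous assignment, whatever its order and repetitions.\<close>

lemma fold_assign:
  assumes "\<And>a R R'. a \<in> set as \<Longrightarrow> (\<And>x. x \<notin> set as \<Longrightarrow> R x = R' x) \<Longrightarrow> v a R = v a R'"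
  shows "fold (\<lambda>a R. R(a := v a R)) as R = (\<lambda>r. if r \<in> set as then v r R else R r)"
proof -
  have "set bs \<subseteq> set as \<Longrightarrow>
    fold (\<lambda>a R. R(a := v a R)) bs R = (\<lambda>r. if r \<in> set bs then v r R else R r)" for bs
  proof (induction bs rule: rev_induct)
    case (snoc b bs)
    then have vb: "v b (\<lambda>r. if r \<in> set bs then v r R else R r) = v b R"
      by (intro assms) auto
    have IH: "fold (\<lambda>a R. R(a := v a R)) bs R = (\<lambda>r. if r \<in> set bs then v r R else R r)"
      by (rule snoc.IH) (use snoc.prems in auto)
    have eq: "fold (\<lambda>a R. R(a := v a R)) (bs @ [b]) R
      = (fold (\<lambda>a R. R(a := v a R)) bs R)(b := v b (fold (\<lambda>a R. R(a := v a R)) bs R))"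
      by simp
    show ?case unfolding eq IH vb by (auto simp: fun_eq_iff)
  qed simp
  then show ?thesis by blast
qed

lemma fold_concat_map:
  assumes "\<And>a R. a \<in> set as \<Longrightarrow> fold effect (blk a) R = R(a := v a R)"
  shows "fold effect (concat (map blk as)) R = fold (\<lambda>a R. R(a := v a R)) as R"
  using assms by (induction as arbitrary: R) auto

section \<open>Register layout of graphs and the rewriting program\<close>

lemma finite_vertex_pairs [simp]: "finite (vertex_pairs N)"
  by (rule finite_subset[of _ "{..<N} \<times> {..<N}"]) (auto simp: vertex_pairs_def)

definition edge_register :: "nat \<times> nat \<Rightarrow> nat" where
  "edge_register = (\<lambda>(i, j). 1 + (j choose 2) + i)"

text \<open>The pairs with larger endpoint \<open>j\<close> occupy the registers from
  \<open>1 + (j choose 2)\<close> to \<open>Suc j choose 2\<close>, and these intervals are disjoint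
  for different \<open>j\<close>.\<close>

lemma edge_register_inj: "inj_on edge_register (vertex_pairs N)"
proof -
  have less: "(j choose 2) + i < (j' choose 2) + i'" if "i < j" "j < j'" for i j i' j' :: nat
  proof -
    have "(j choose 2) + i < (Suc j choose 2)" using that by (simp add: numeral_2_eq_2)
    also have "\<dots> \<le> (j' choose 2)" using that by (intro binomial_right_mono) auto
    finally show ?thesis by simp
  qed
  show ?thesis
  proof (rule inj_onI, clarify)
    fix i j i' j' assume *: "(i, j) \<in> vertex_pairs N" "(i', j') \<in> vertex_pairs N"
      "edge_register (i, j) = edge_register (i', j')"
    then have "j = j'" using less[of i j j' i'] less[of i' j' j i]
      by (cases j j' rule: linorder_cases) (auto simp: edge_register_def vertex_pairs_def)
    with * show "i = i' \<and> j = j'" by (auto simp: edge_register_def)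
  qed
qed

lemma edge_register_le:
  assumes "e \<in> vertex_pairs N" shows "0 < edge_register e" "edge_register e < N\<^sup>2 + 1"
proof -
  obtain i j where e: "e = (i, j)" "i < j" "j < N" using assms by (auto simp: vertex_pairs_def)
  have "(j choose 2) + i < (Suc j choose 2)" using e by (simp add: numeral_2_eq_2)
  also have "\<dots> \<le> (N choose 2)" using e by (intro binomial_right_mono) auto
  also have "\<dots> \<le> N\<^sup>2" by (simp add: choose_two power2_eq_square) (metis diff_le_self div_le_dividend le_trans mult_le_mono2)
  finally show "edge_register e < N\<^sup>2 + 1" by (simp add: edge_register_def e)
qed (auto simp: edge_register_def split: prod.split)

definition registers :: "nat \<Rightarrow> graph \<Rightarrow> nat \<Rightarrow> nat" where
  "registers N G r =
    (if r = 0 then N else of_bool (\<exists>e\<in>vertex_pairs N. r = edge_register e \<and> G e))"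

lemma initial_config_registers: "initial_config N G = (0, registers N G)"
  by (auto simp: initial_config_def registers_def edge_register_def fun_eq_iff)

lemma registers_edge:
  assumes "e \<in> vertex_pairs N" shows "registers N G (edge_register e) = of_bool (G e)"
  using assms edge_register_le[OF assms] edge_register_inj[of N]
  by (auto simp: registers_def inj_on_def)

text \<open>\<open>u e\<close> and \<open>v e\<close> tabulate one of the four Boolean functions of
  a single bit. \<open>src e\<close> may lie outside \<open>vertex_pairs n\<close>, where a graph is
  constantly \<open>False\<close>; this covers pairs inside one block.\<close>

definition local_rewriting :: "nat \<Rightarrow> nat \<Rightarrow> (graph \<Rightarrow> graph) \<Rightarrow> bool" where
  "local_rewriting n N F \<longleftrightarrow>
     (\<forall>G \<in> graphs n. F G \<in> graphs N) \<and>
     (\<exists>src u v. \<forall>G e. e \<in> vertex_pairs N \<longrightarrow> F G e = (if G (src e) then u e else v e))"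

lemma effect_Incr_funpow: "(effect (Incr a) ^^ m) R = R(a := R a + m)"
  by (induction m) (auto simp: fun_eq_iff)

text \<open>Input and output share the same registers. Therefore the input is copied to the
  registers from \<open>V\<close> to \<open>2 * V - 1\<close>, the output is written from this copy,
  and the copy is erased: the program of the test is only known to be correct on an exact initial
  configuration.\<close>

lemma rewriting_program:
  assumes F: "local_rewriting n N F" and nN: "n \<le> N"
  obtains xs where "\<forall>x\<in>set xs. straight x" "length xs \<le> 12 * N\<^sup>2 + 12"
    "\<And>G. G \<in> graphs n \<Longrightarrow> fold effect xs (registers n G) = registers N (F G)"
proof -
  obtain src u v where FG: "\<And>G e. e \<in> vertex_pairs N \<Longrightarrow> F G e = (if G (src e) then u e else v e)"
    and Fgr: "\<And>G. G \<in> graphs n \<Longrightarrow> F G \<in> graphs N"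
    using F by (auto simp: local_rewriting_def)
  \<comment> \<open>Because \<open>n \<le> N\<close>, all registers used by either graph lie below
    \<open>V\<close>.\<close>
  define V where "V = N\<^sup>2 + 1"
  define copy where "copy a = [Add a (a - V)]" for a
  \<comment> \<open>The target has just been cleared. The cases are constant 1, copy, negation
    (truncated subtraction from 1) and constant 0; a source outside \<open>vertex_pairs n\<close>
    reads as \<open>False\<close> and yields \<open>v e\<close>.\<close>
  define bit where "bit e =
    (if src e \<in> vertex_pairs n then
       let s = edge_register (src e) + V; a = edge_register e in
       if u e then if v e then [Incr a] else [Add a s] else if v e then [Incr a, Sub a s] else []
     else if v e then [Incr (edge_register e)] else [])" for e
  define bitval where "bitval e R =
    (if src e \<in> vertex_pairs n then
       let s = R (edge_register (src e) + V) in
       if u e then if v e then 1 else s else if v e then 1 - s else 0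
     else of_bool (v e))" for e and R :: "nat \<Rightarrow> nat"
  define pair_at where "pair_at a = (THE e. e \<in> vertex_pairs N \<and> edge_register e = a)" for a
  \<comment> \<open>\<open>wr\<close> runs through registers, so the pair stored in a register has
    to be recovered.\<close>
  have pair_at: "pair_at (edge_register e) = e" if "e \<in> vertex_pairs N" for e
    unfolding pair_at_def using that edge_register_inj[of N] by (auto simp: inj_on_def)
  define wr where "wr a = Zero a # (if a = 0 then replicate N (Incr 0)
     else if a \<in> edge_register ` vertex_pairs N then bit (pair_at a) else [])" for a
  define wrval where "wrval a R = (if a = 0 then N
     else if a \<in> edge_register ` vertex_pairs N then bitval (pair_at a) R else 0)"
     for a and R :: "nat \<Rightarrow> nat"
  define xs where "xs = concat (map copy [V..<2*V]) @ concat (map wr [0..<V]) @ map Zero [V..<2*V]"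
  have nV: "edge_register e < V" if "e \<in> vertex_pairs n" for e
    using edge_register_le(2)[OF that] power_mono[OF nN, of 2] unfolding V_def by linarith
  have NV: "edge_register e < V" if "e \<in> vertex_pairs N" for e
    using edge_register_le(2)[OF that] by (simp add: V_def)
  have straight: "\<forall>x\<in>set xs. straight x"
    by (auto simp: xs_def copy_def wr_def bit_def Let_def split: if_splits)
  have "length (concat (map copy [V..<2*V])) = V"
    by (simp add: length_concat copy_def o_def sum_list_triv)
  moreover have "length (concat (map wr [0..<V])) \<le> 3 * V + Suc N"
  proof -
    have "0 < V" by (simp add: V_def)
    have V: "[0..<V] = 0 # [1..<V]" using upt_conv_Cons[of 0 V] \<open>0 < V\<close> by simp
    have "length (bit e) \<le> 2" for e by (auto simp: bit_def Let_def)
    then have "(\<Sum>a\<leftarrow>[1..<V]. length (wr a)) \<le> (\<Sum>a\<leftarrow>[1..<V]. 3)"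
      by (intro sum_list_mono) (auto simp: wr_def)
    then have "(\<Sum>a\<leftarrow>[1..<V]. length (wr a)) \<le> 3 * V"
      by (simp add: sum_list_triv del: upt_Suc)
    moreover have "length (wr 0) = Suc N" by (simp add: wr_def)
    moreover have "length (concat (map wr [0..<V])) = length (wr 0) + (\<Sum>a\<leftarrow>[1..<V]. length (wr a))"
      unfolding V by (simp add: length_concat o_def)
    ultimately show ?thesis by linarith
  qed
  moreover have "N \<le> N\<^sup>2" by (simp add: power2_eq_square)
  moreover have "length xs = length (concat (map copy [V..<2*V])) + length (concat (map wr [0..<V])) + V"
    by (simp add: xs_def del: upt_Suc)
  moreover have V_eq: "V = N\<^sup>2 + 1" by (fact V_def)
  ultimately have "length xs \<le> 12 * N\<^sup>2 + 12" using V_eq by linarith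
  moreover have "fold effect xs (registers n G) = registers N (F G)" if G: "G \<in> graphs n" for G
  proof -
    define R1 where "R1 = (\<lambda>r. if V \<le> r \<and> r < 2 * V then registers n G (r - V) else registers n G r)"
    define R2 where "R2 = (\<lambda>r. if r < V then wrval r R1 else R1 r)"
    have zero: "registers n G r = 0" if "V \<le> r" for r
      using that V_eq by (auto simp: registers_def dest: nV)
    have 1: "fold effect (concat (map copy [V..<2*V])) (registers n G) = R1"
    proof -
      have "fold effect (concat (map copy [V..<2*V])) (registers n G)
        = fold (\<lambda>a R. R(a := R a + R (a - V))) [V..<2*V] (registers n G)"
        by (rule fold_concat_map) (simp add: copy_def)
      \<comment> \<open>\<open>Add\<close> also reads its own target. Every target is visited once,
        so its old value can be frozen to the initial one, which gives the loop the form required by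
        \<open>fold_assign\<close>; that value is 0, so addition copies.\<close>
      also have "\<dots> = fold (\<lambda>a R. R(a := (\<lambda>a R. registers n G a + R (a - V)) a R)) [V..<2*V] (registers n G)"
      proof -
        have "distinct bs \<Longrightarrow> (\<And>a. a \<in> set bs \<Longrightarrow> R a = registers n G a) \<Longrightarrow>
          fold (\<lambda>a R. R(a := R a + R (a - V))) bs R
          = fold (\<lambda>a R. R(a := registers n G a + R (a - V))) bs R" for bs R
        proof (induction bs arbitrary: R)
          case (Cons a bs)
          have "fold (\<lambda>a R. R(a := R a + R (a - V))) bs (R(a := registers n G a + R (a - V)))
            = fold (\<lambda>a R. R(a := registers n G a + R (a - V))) bs (R(a := registers n G a + R (a - V)))"
            by (rule Cons.IH) (use Cons.prems in auto)
          moreover have "R a = registers n G a" using Cons.prems by simp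
          ultimately show ?case by (simp only: fold.simps o_apply)
        qed simp
        then show ?thesis by simp
      qed
      also have "\<dots> = (\<lambda>r. if r \<in> set [V..<2*V] then registers n G r + registers n G (r - V) else registers n G r)"
      proof (rule fold_assign)
        fix a and R R' :: "nat \<Rightarrow> nat"
        assume a: "a \<in> set [V..<2*V]" and RR': "\<And>x. x \<notin> set [V..<2*V] \<Longrightarrow> R x = R' x"
        have "a - V \<notin> set [V..<2*V]" using a by (simp del: upt_Suc) linarith
        then have "R (a - V) = R' (a - V)" by (rule RR')
        then show "registers n G a + R (a - V) = registers n G a + R' (a - V)" by (rule arg_cong)
      qed
      finally show ?thesis by (auto simp: R1_def zero fun_eq_iff)
    qed
    have 2: "fold effect (concat (map wr [0..<V])) R1 = R2"
    proof -
      have "fold effect (concat (map wr [0..<V])) R1 = fold (\<lambda>a R. R(a := wrval a R)) [0..<V] R1"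
      proof (rule fold_concat_map)
        fix a R assume a: "a \<in> set [0..<V]"
        show "fold effect (wr a) R = R(a := wrval a R)"
        proof (cases "a \<in> edge_register ` vertex_pairs N")
          case True
          then obtain e where e: "e \<in> vertex_pairs N" "a = edge_register e" by auto
          have "a < V" "0 < a" using edge_register_le[OF e(1)] e by (auto simp: V_def)
          then show ?thesis using True e pair_at[OF e(1)]
            by (auto simp: wr_def wrval_def bit_def bitval_def Let_def fun_eq_iff)
        qed (auto simp: wr_def wrval_def effect_Incr_funpow)
      qed
      also have "\<dots> = (\<lambda>r. if r \<in> set [0..<V] then wrval r R1 else R1 r)"
        by (rule fold_assign) (auto simp: wrval_def bitval_def Let_def)
      finally show ?thesis by (auto simp: R2_def fun_eq_iff)
    qed
    have 3: "fold effect (map Zero [V..<2*V]) R2 = (\<lambda>r. if V \<le> r \<and> r < 2 * V then 0 else R2 r)"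
    proof -
      have blocks: "map Zero [V..<2*V] = concat (map (\<lambda>a. [Zero a]) [V..<2*V])" by (induction "[V..<2*V]") auto
      have "fold effect (map Zero [V..<2*V]) R2 = fold (\<lambda>a R. R(a := 0)) [V..<2*V] R2"
        unfolding blocks by (rule fold_concat_map) simp
      also have "\<dots> = (\<lambda>r. if r \<in> set [V..<2*V] then 0 else R2 r)" by (rule fold_assign) simp
      finally show ?thesis by auto
    qed
    have R1: "R1 (edge_register e + V) = of_bool (G e)" if "e \<in> vertex_pairs n" for e
      using nV[OF that] registers_edge[OF that] by (simp add: R1_def)
    have "registers N (F G) r = (if V \<le> r \<and> r < 2 * V then 0 else R2 r)" for r
    proof (cases "r < V")
      case True
      show ?thesis
      proof (cases "r \<in> edge_register ` vertex_pairs N")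
        case in_pairs: True
        then obtain e where e: "e \<in> vertex_pairs N" "r = edge_register e" by auto
        have "src e \<notin> vertex_pairs n \<Longrightarrow> \<not> G (src e)" using G unfolding graphs_def by blast
        then show ?thesis
          using True e edge_register_le[OF e(1)] pair_at[OF e(1)] in_pairs
          by (auto simp: R2_def wrval_def registers_edge bitval_def R1 FG Let_def)
      next
        case False
        with True show ?thesis by (auto simp: R2_def wrval_def registers_def)
      qed
    next
      case False
      then have "registers N (F G) r = 0" using NV by (auto simp: registers_def V_def)
      with False zero show ?thesis by (auto simp: R2_def R1_def)
    qed
    then have "registers N (F G) = (\<lambda>r. if V \<le> r \<and> r < 2 * V then 0 else R2 r)" by (rule ext)
    then show ?thesis by (simp only: xs_def fold_append o_apply 1 2 3)
  qed
  ultimately show ?thesis using that straight by blast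
qed

text \<open>The prefix takes one step per instruction, and the surplus steps are spent in a halted
  configuration, which does not change.\<close>

lemma computes_rewriting:
  assumes F: "local_rewriting n N F" and nN: "n \<le> N" and P: "computes_within P N T \<phi>"
    and T': "T + 12 * N\<^sup>2 + 12 \<le> T'"
  obtains P' where "length P' \<le> length P + 12 * N\<^sup>2 + 12" "computes_within P' n T' (\<lambda>G. \<phi> (F G))"
proof -
  obtain xs where xs: "\<forall>x\<in>set xs. straight x" "length xs \<le> 12 * N\<^sup>2 + 12"
    "\<And>G. G \<in> graphs n \<Longrightarrow> fold effect xs (registers n G) = registers N (F G)"
    using rewriting_program[OF F nN] by metis
  define P' where "P' = xs @ map (shift_jump (length xs)) P"
  obtain s where s: "T' = (length xs + T) + s"
    using T' xs(2) by (metis add.assoc add.commute add_le_mono le_Suc_ex le_trans order_refl)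
  have "(\<forall>c \<in> set_pmf (run P' T' (initial_config n G)). halted P' c) \<and>
        map_pmf (\<lambda>(pc, R). R 0 \<noteq> 0) (run P' T' (initial_config n G)) = \<phi> (F G)"
    if G: "G \<in> graphs n" for G
  proof -
    have FG: "F G \<in> graphs N" using F G by (auto simp: local_rewriting_def)
    let ?sh = "apfst ((+) (length xs)) :: config \<Rightarrow> config"
    have "run P' (length xs + T) (initial_config n G) = run P' T (length xs, registers N (F G))"
      using run_straight[OF xs(1) order_refl, of "map (shift_jump (length xs)) P" "registers n G"] xs(3)[OF G]
      by (simp add: run_add initial_config_registers P'_def bind_return_pmf)
    also have "\<dots> = map_pmf ?sh (run P T (initial_config N (F G)))"
      using run_shift_jump[of xs P T "initial_config N (F G)"]
      by (simp add: P'_def initial_config_registers)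
    finally have run: "run P' (length xs + T) (initial_config n G)
      = map_pmf ?sh (run P T (initial_config N (F G)))" .
    have halt: "halted P' (?sh c)" if "c \<in> set_pmf (run P T (initial_config N (F G)))" for c
      using P FG that by (cases c) (fastforce simp: computes_within_def halted_def P'_def)
    have "run P' T' (initial_config n G) = run P' (length xs + T) (initial_config n G) \<bind> run P' s"
      unfolding s by (rule run_add)
    also have "\<dots> = run P T (initial_config N (F G)) \<bind> (\<lambda>c. run P' s (?sh c))"
      by (simp add: run bind_map_pmf)
    also have "\<dots> = run P T (initial_config N (F G)) \<bind> (\<lambda>c. return_pmf (?sh c))"
      by (intro bind_pmf_cong refl run_halted halt)
    finally have "run P' T' (initial_config n G) = map_pmf ?sh (run P T (initial_config N (F G)))"
      by (simp add: map_pmf_def)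
    moreover have "map_pmf (\<lambda>(pc, R). R 0 \<noteq> 0) (run P T (initial_config N (F G))) = \<phi> (F G)"
      using P FG by (simp add: computes_within_def)
    ultimately show ?thesis using halt
      by (auto simp: pmf.map_comp o_def case_prod_unfold)
  qed
  then have "computes_within P' n T' (\<lambda>G. \<phi> (F G))" by (simp add: computes_within_def)
  moreover have "length P' \<le> length P + 12 * N\<^sup>2 + 12" using xs(2) by (simp add: P'_def)
  ultimately show ?thesis using that by blast
qed

text \<open>Register 0 already holds \<open>n\<close>, so the empty program gives this answer. It
  serves the index 0, where no reduction exists.\<close>

lemma computes_trivial: "computes_within [] n T (\<lambda>G. return_pmf (n \<noteq> 0))"
  by (auto simp: computes_within_def run_halted halted_def initial_config_def)


section \<open>Random partitions into blocks\<close>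

lemma expect_bind_finite:
  fixes f :: "'a \<Rightarrow> 'b pmf" and h :: "'b \<Rightarrow> real"
  assumes "finite (set_pmf p)" "\<And>x. x \<in> set_pmf p \<Longrightarrow> finite (set_pmf (f x))"
  shows "expect (p \<bind> f) h = expect p (\<lambda>x. expect (f x) h)"
  using assms by (subst pmf_expectation_bind[of "set_pmf p"])
    (auto simp: integral_measure_pmf[of "set_pmf p"])

definition vertex_map :: "nat \<Rightarrow> nat \<Rightarrow> (nat \<Rightarrow> nat) pmf" where
  "vertex_map N n = Pi_pmf {..<N} 0 (\<lambda>_. pmf_of_set {..<n})"

definition load_le :: "nat \<Rightarrow> nat \<Rightarrow> nat \<Rightarrow> (nat \<Rightarrow> nat) \<Rightarrow> bool" where
  "load_le N n L f \<longleftrightarrow> (\<forall>c<n. card {v \<in> {..<N}. f v = c} \<le> L)"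

lemma lessThan_nonempty: "0 < n \<Longrightarrow> {..<n} \<noteq> {}" for n :: nat
  by auto

lemma finite_vertex_map: "0 < n \<Longrightarrow> finite (set_pmf (vertex_map N n))"
  by (auto simp: vertex_map_def lessThan_nonempty intro!: finite_set_Pi_pmf)

lemma prod_if_one: "finite A \<Longrightarrow> (\<Prod>x\<in>A. if P x then c else 1) = (c :: real) ^ card {x \<in> A. P x}"
  by (subst prod.inter_filter[symmetric]) simp_all

text \<open>Markov's inequality for 2 to the power of the load of a block, whose mean is
  \<open>(1 + 1 / n) ^ N\<close> by independence, and a union bound over the \<open>n\<close>
  blocks.\<close>

lemma overload_prob:
  assumes n: "0 < n"
  shows "measure_pmf.prob (vertex_map N n) {f. \<not> load_le N n L f} \<le> n * ((1 + 1 / n) ^ N / 2 ^ L)"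
proof -
  note [simp] = integrable_measure_pmf_finite[OF finite_vertex_map[OF n]]
  have one: "expect (pmf_of_set {..<n}) (\<lambda>y. if y = c then 2 else 1) = 1 + 1 / n" if "c < n" for c
  proof -
    have "(\<Sum>y<n. if y = c then 2 else 1 :: real) = (\<Sum>y<n. 1 + (if y = c then 1 else 0))"
      by (intro sum.cong) auto
    also have "\<dots> = n + 1" using that by (simp only: sum.distrib) simp
    finally show ?thesis using n by (simp add: integral_pmf_of_set lessThan_nonempty field_simps)
  qed
  have "measure_pmf.prob (vertex_map N n) {f. \<not> load_le N n L f}
    \<le> expect (vertex_map N n) (\<lambda>f. \<Sum>c<n. (\<Prod>v<N. if f v = c then 2 else 1) / 2 ^ L)"
    unfolding prob_eq_expect
  proof (intro integral_mono)
    fix f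
    show "of_bool (f \<in> {f. \<not> load_le N n L f}) \<le> (\<Sum>c<n. (\<Prod>v<N. if f v = c then 2 else 1) / 2 ^ L :: real)"
    proof (cases "load_le N n L f")
      case False
      then obtain c where c: "c < n" "L < card {v \<in> {..<N}. f v = c}" by (auto simp: load_le_def not_le)
      have "(1::real) \<le> 2 ^ card {v \<in> {..<N}. f v = c} / 2 ^ L"
        using c by (simp add: power_increasing)
      also have "\<dots> = (\<Prod>v<N. if f v = c then 2 else 1) / 2 ^ L" by (subst prod_if_one) simp_all
      also have "\<dots> \<le> (\<Sum>c<n. (\<Prod>v<N. if f v = c then 2 else 1) / 2 ^ L)"
        using c by (intro member_le_sum) (auto intro!: prod_nonneg divide_nonneg_nonneg)
      finally show ?thesis by simp
    qed (auto intro!: sum_nonneg prod_nonneg divide_nonneg_nonneg)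
  qed auto
  also have "\<dots> = (\<Sum>c<n. expect (vertex_map N n) (\<lambda>f. \<Prod>v<N. if f v = c then 2 else 1) / 2 ^ L)"
    by simp
  also have "\<dots> = (\<Sum>c<n. (1 + 1 / n) ^ N / 2 ^ L)"
  proof (intro sum.cong refl)
    fix c assume "c \<in> {..<n}"
    then have "expect (vertex_map N n) (\<lambda>f. \<Prod>v<N. if f v = c then 2 else 1) = (1 + 1 / n) ^ N"
      unfolding vertex_map_def using n
      by (subst expectation_prod_Pi_pmf)
        (auto simp: one lessThan_nonempty intro!: integrable_measure_pmf_finite)
    then show "expect (vertex_map N n) (\<lambda>f. \<Prod>v<N. if f v = c then 2 else 1) / 2 ^ L
      = (1 + 1 / n) ^ N / 2 ^ L" by simp
  qed
  finally show ?thesis by simp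
qed

text \<open>\<open>b\<close> marks the planted vertices. The colliding pairs are the defective ones:
  planted, but with density \<open>q\<close> because they lie inside one block.\<close>

definition collides :: "(nat \<Rightarrow> bool) \<Rightarrow> (nat \<Rightarrow> nat) \<Rightarrow> nat \<times> nat \<Rightarrow> bool" where
  "collides b f = (\<lambda>(i, j). b i \<and> b j \<and> f i = f j)"

text \<open>Linear in \<open>y\<close>, so that averaging needs only the mean number of collisions.
  Each of the \<open>y\<close> increments is at most
  \<open>\<rho> * (1 + \<rho>) ^ L\<close>.\<close>

lemma one_plus_power_le:
  fixes \<rho> :: real
  assumes "0 \<le> \<rho>" "y \<le> L" shows "(1 + \<rho>) ^ y \<le> 1 + y * (\<rho> * (1 + \<rho>) ^ L)"
  using assms(2)
proof (induction y)
  case (Suc y)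
  have "(1 + \<rho>) ^ Suc y = (1 + \<rho>) ^ y + \<rho> * (1 + \<rho>) ^ y" by (simp add: algebra_simps)
  also have "\<dots> \<le> (1 + y * (\<rho> * (1 + \<rho>) ^ L)) + \<rho> * (1 + \<rho>) ^ L"
    using Suc assms(1) by (intro add_mono mult_left_mono power_increasing) auto
  finally show ?case by (simp add: algebra_simps)
qed simp

lemma sum_card_fibres_le:
  assumes "finite C" "finite T" shows "(\<Sum>y\<in>C. card {i \<in> T. f i = y}) \<le> card T"
proof -
  have "(\<Sum>y\<in>C. card {i \<in> T. f i = y}) = card (\<Union>y\<in>C. {i \<in> T. f i = y})"
    using assms by (intro card_UN_disjoint[symmetric]) auto
  also have "\<dots> \<le> card T" using assms by (intro card_mono) auto
  finally show ?thesis .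
qed

text \<open>
  The values of \<open>f\<close> are revealed one vertex at a time; by the load bound on \<open>f'\<close>,
  each new vertex can collide with at most \<open>L\<close> earlier ones.
\<close>

lemma collision_moment:
  assumes C: "finite C" "C \<noteq> {}" and D: "\<And>v. finite (set_pmf (D v))" and \<rho>: "0 \<le> \<rho>"
    and load: "\<And>v. v < N \<Longrightarrow> b v \<Longrightarrow> card {w \<in> {..<N}. b w \<and> f' w = f' v} \<le> L"
    and m: "m \<le> N"
  defines "p \<equiv> \<lambda>v. if b v then pmf_of_set C else D v"
  shows "expect (Pi_pmf {..<m} 0 p)
      (\<lambda>f. (1 + \<rho>) ^ card {e \<in> vertex_pairs m. collides b f e \<and> collides b f' e})
    \<le> (1 + L * (\<rho> * (1 + \<rho>) ^ L) / card C) ^ card {v \<in> {..<m}. b v}"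
  using m
proof (induction m)
  case 0
  then show ?case by (simp add: vertex_pairs_def)
next
  case (Suc m)
  define X where "X f = card {e \<in> vertex_pairs m. collides b f e \<and> collides b f' e}" for f
  \<comment> \<open>New common collisions at vertex \<open>m\<close> involve only \<open>T\<close>,
    the earlier planted vertices in its \<open>f'\<close>-block; if \<open>f\<close> sends
    \<open>m\<close> to \<open>y\<close>, there are \<open>Y f y\<close> of them.\<close>
  define T where "T = {i \<in> {..<m}. b i \<and> b m \<and> f' i = f' m}"
  define Y where "Y f y = card {i \<in> T. f i = y}" for f :: "nat \<Rightarrow> nat" and y
  let ?\<alpha> = "1 + L * (\<rho> * (1 + \<rho>) ^ L) / card C"
  have fin_p: "finite (set_pmf (p v))" for v using C D by (simp add: p_def)
  have fin_Pi: "finite (set_pmf (Pi_pmf {..<m} 0 p))" using fin_p by (intro finite_set_Pi_pmf) auto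
  have count: "card {e \<in> vertex_pairs (Suc m). collides b (f(m := y)) e \<and> collides b f' e} = X f + Y f y" for f y
  proof -
    have "{e \<in> vertex_pairs (Suc m). collides b (f(m := y)) e \<and> collides b f' e}
      = {e \<in> vertex_pairs m. collides b f e \<and> collides b f' e} \<union> (\<lambda>i. (i, m)) ` {i \<in> T. f i = y}"
      by (auto simp: vertex_pairs_def collides_def T_def less_Suc_eq)
    moreover have "card ((\<lambda>i. (i, m)) ` {i \<in> T. f i = y}) = Y f y"
      unfolding Y_def by (intro card_image) (auto simp: inj_on_def)
    moreover have "{e \<in> vertex_pairs m. collides b f e \<and> collides b f' e} \<inter> (\<lambda>i. (i, m)) ` {i \<in> T. f i = y} = {}"
      by (auto simp: vertex_pairs_def)
    moreover have "finite T" by (simp add: T_def)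
    ultimately show ?thesis by (simp add: card_Un_disjoint X_def)
  qed
  have insert: "{..<Suc m} = insert m {..<m}" by auto
  have one: "expect (p m) (\<lambda>y. (1 + \<rho>) ^ Y f y) \<le> (if b m then ?\<alpha> else 1)" for f
  proof (cases "b m")
    case True
    have "card T \<le> card {w \<in> {..<N}. b w \<and> f' w = f' m}"
      using Suc.prems by (intro card_mono) (auto simp: T_def)
    also have "\<dots> \<le> L" using Suc.prems True by (intro load) auto
    finally have TL: "card T \<le> L" .
    have T: "finite T" by (simp add: T_def)
    have YL: "Y f y \<le> L" for y
      unfolding Y_def by (rule order_trans[OF card_mono TL]) (use T in auto)
    have "(\<Sum>y\<in>C. (1 + \<rho>) ^ Y f y) \<le> (\<Sum>y\<in>C. 1 + Y f y * (\<rho> * (1 + \<rho>) ^ L))"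
      using \<rho> YL by (intro sum_mono one_plus_power_le)
    also have "\<dots> = card C + (\<Sum>y\<in>C. Y f y) * (\<rho> * (1 + \<rho>) ^ L)"
      by (simp add: sum.distrib sum_distrib_right)
    also have "\<dots> \<le> card C + L * (\<rho> * (1 + \<rho>) ^ L)"
      using sum_card_fibres_le[OF C(1) T, of f] TL \<rho> unfolding Y_def
      by (intro add_left_mono mult_right_mono) (auto simp flip: of_nat_sum)
    finally have "(\<Sum>y\<in>C. (1 + \<rho>) ^ Y f y) \<le> card C + L * (\<rho> * (1 + \<rho>) ^ L)" .
    moreover have "0 < card C" using C by (simp add: card_gt_0_iff)
    ultimately show ?thesis using True C
      by (simp add: p_def integral_pmf_of_set field_simps)
  qed (simp add: Y_def T_def)
  have "expect (Pi_pmf {..<Suc m} 0 p)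
      (\<lambda>f. (1 + \<rho>) ^ card {e \<in> vertex_pairs (Suc m). collides b f e \<and> collides b f' e})
    = expect (p m) (\<lambda>y. expect (Pi_pmf {..<m} 0 p) (\<lambda>f. (1 + \<rho>) ^ (X f + Y f y)))"
    unfolding insert using fin_p fin_Pi
    by (subst Pi_pmf_insert') (simp_all add: expect_bind_finite flip: count insert)
  \<comment> \<open>The value at \<open>m\<close> is averaged first, with the earlier values fixed;
    \<open>one\<close> bounds this inner mean uniformly in \<open>f\<close>.\<close>
  also have "\<dots> = expect (Pi_pmf {..<m} 0 p) (\<lambda>f. (1 + \<rho>) ^ X f * expect (p m) (\<lambda>y. (1 + \<rho>) ^ Y f y))"
    by (subst expect_swap[OF fin_p fin_Pi]) (simp add: power_add)
  also have "\<dots> \<le> expect (Pi_pmf {..<m} 0 p) (\<lambda>f. (1 + \<rho>) ^ X f * (if b m then ?\<alpha> else 1))"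
    using \<rho> one fin_Pi by (intro integral_mono integrable_measure_pmf_finite mult_left_mono) auto
  also have "\<dots> = expect (Pi_pmf {..<m} 0 p) (\<lambda>f. (1 + \<rho>) ^ X f) * (if b m then ?\<alpha> else 1)"
    by simp
  also have "\<dots> \<le> ?\<alpha> ^ card {v \<in> {..<m}. b v} * (if b m then ?\<alpha> else 1)"
    using Suc \<rho> by (intro mult_right_mono) (auto simp: X_def intro!: add_nonneg_nonneg divide_nonneg_nonneg)
  also have "\<dots> = ?\<alpha> ^ card {v \<in> {..<Suc m}. b v}"
  proof (cases "b m")
    case True
    then have "{v \<in> {..<Suc m}. b v} = insert m {v \<in> {..<m}. b v}" by auto
    with True show ?thesis by simp
  next
    case False
    then have "{v \<in> {..<Suc m}. b v} = {v \<in> {..<m}. b v}" by (auto simp: less_Suc_eq)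
    with False show ?thesis by simp
  qed
  finally show ?case .
qed

text \<open>The conditional law of the partition, given that exactly the vertices marked by
  \<open>b\<close> are sent into \<open>C\<close>.\<close>

definition vertex_map_given :: "nat \<Rightarrow> nat \<Rightarrow> nat set \<Rightarrow> (nat \<Rightarrow> bool) \<Rightarrow> (nat \<Rightarrow> nat) pmf" where
  "vertex_map_given N n C b =
     Pi_pmf {..<N} 0 (\<lambda>v. if b v then pmf_of_set C else pmf_of_set ({..<n} - C))"

lemma complement_nonempty:
  assumes "C \<subseteq> {..<n}" "card C < n" shows "{..<n} - C \<noteq> {}"
proof
  assume "{..<n} - C = {}"
  with assms(1) have "C = {..<n}" by blast
  with assms(2) show False by simp
qed

text \<open>A uniform old vertex may be drawn by first deciding whether it lies in \<open>C\<close>.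
  Hence the preimage of the clique contains each new vertex independently with probability
  \<open>card C / n\<close>, just like the planted set of \<open>planted_dense_subgraph\<close> when
  \<open>K / N = card C / n\<close>.\<close>

lemma vertex_map_bind:
  assumes C: "C \<subseteq> {..<n}" "0 < card C" "card C < n"
  shows "vertex_map N n =
    Pi_pmf {..<N} False (\<lambda>_. bernoulli_pmf (card C / n)) \<bind> vertex_map_given N n C"
proof -
  have fin: "finite C" using C(1) finite_subset by blast
  have C0: "C \<noteq> {}" using C(2) by auto
  have D: "card ({..<n} - C) = n - card C" using C(1) fin by (simp add: card_Diff_subset)
  have D0: "{..<n} - C \<noteq> {}" using C(1,3) by (rule complement_nonempty)
  have "pmf_of_set {..<n} = bernoulli_pmf (card C / n) \<bind>
    (\<lambda>x. if x then pmf_of_set C else pmf_of_set ({..<n} - C))" (is "_ = ?r")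
  proof (rule pmf_eqI)
    fix y
    have "pmf ?r y = card C / n * pmf (pmf_of_set C) y
        + (1 - card C / n) * pmf (pmf_of_set ({..<n} - C)) y"
      using C by (simp add: pmf_bind mult.commute)
    also have "\<dots> = pmf (pmf_of_set {..<n}) y"
      using C C0 D0 D fin by (auto simp: lessThan_nonempty indicator_def of_nat_diff field_simps)
    finally show "pmf (pmf_of_set {..<n}) y = pmf ?r y" ..
  qed
  then show ?thesis
    unfolding vertex_map_def vertex_map_given_def by (simp add: Pi_pmf_bind[where d' = False])
qed

lemma vertex_map_given_set:
  assumes C: "C \<subseteq> {..<n}" "0 < card C" "card C < n"
    and f: "f \<in> set_pmf (vertex_map_given N n C b)" and v: "v < N"
  shows "f v \<in> C \<longleftrightarrow> b v" "f v < n"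
proof -
  have fin: "finite C" using C(1) finite_subset by blast
  have C0: "C \<noteq> {}" using C(2) by auto
  have D0: "{..<n} - C \<noteq> {}" using C(1,3) by (rule complement_nonempty)
  have "f v \<in> set_pmf (if b v then pmf_of_set C else pmf_of_set ({..<n} - C))"
    using f v by (auto simp: vertex_map_given_def set_Pi_pmf PiE_dflt_def)
  then have "f v \<in> (if b v then C else {..<n} - C)" using C0 D0 fin by (cases "b v") simp_all
  then show "f v \<in> C \<longleftrightarrow> b v" "f v < n" using C(1) by (auto split: if_splits)
qed

lemma finite_vertex_map_given:
  assumes C: "C \<subseteq> {..<n}" "0 < card C" "card C < n"
  shows "finite (set_pmf (vertex_map_given N n C b))"
proof -
  have fin: "finite C" using C(1) finite_subset by blast
  have C0: "C \<noteq> {}" using C(2) by auto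
  have D0: "{..<n} - C \<noteq> {}" using C(1,3) by (rule complement_nonempty)
  show ?thesis
    unfolding vertex_map_given_def using C0 D0 fin by (intro finite_set_Pi_pmf) auto
qed

section \<open>Pairs inside one block: comparison with the planted dense subgraph\<close>

definition edge_product :: "nat \<Rightarrow> (nat \<times> nat \<Rightarrow> real) \<Rightarrow> graph pmf" where
  "edge_product N r = Pi_pmf (vertex_pairs N) False (\<lambda>e. bernoulli_pmf (r e))"

lemma finite_edge_product: "finite (set_pmf (edge_product N r))"
  unfolding edge_product_def by (intro finite_set_Pi_pmf) (auto intro: finite_subset[of _ UNIV])

text \<open>The planted set \<open>b\<close> is fixed and the partition is random.
  \<open>\<rho>\<close> is the chi-square divergence of Bernoulli \<open>q\<close> from Bernoulli
  \<open>2 * q\<close>, and every pair collapsed by both of two independent partitions multiplies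
  the second moment by \<open>1 + \<rho>\<close>.\<close>

lemma diagonal_blocks_tv:
  fixes q t \<rho> \<epsilon> \<beta> :: real and L N n :: nat and C :: "nat set" and b :: "nat \<Rightarrow> bool"
  assumes C: "C \<subseteq> {..<n}" "0 < card C" "card C < n"
    and q: "0 < q" "q < 1 / 2" and t: "0 < t"
  defines "\<rho> \<equiv> q / (2 * (1 - 2 * q))"
  defines "\<epsilon> \<equiv> exp (L\<^sup>2 * (\<rho> * (1 + \<rho>) ^ L)) - 1"
  defines "\<beta> \<equiv> measure_pmf.prob (vertex_map_given N n C b) {f. \<not> load_le N n L f}"
  shows "tv_le
    (vertex_map_given N n C b \<bind>
      (\<lambda>f. edge_product N (\<lambda>(i, j). if b i \<and> b j \<and> f i \<noteq> f j then 2 * q else q)))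
    (edge_product N (\<lambda>(i, j). if b i \<and> b j then 2 * q else q))
    (\<beta> + ((\<epsilon> + 2 * \<beta>) / t + t) / 2)"
proof -
  \<comment> \<open>Likelihood ratio of Bernoulli \<open>q\<close> to Bernoulli
    \<open>2 * q\<close>.\<close>
  define r where "r v = (if v then 1 / 2 else (1 - q) / (1 - 2 * q))" for v
  define ratio where "ratio f e v = (if collides b f e then r v else 1)" for f e v
  define \<Lambda> where "\<Lambda> f G = (\<Prod>e\<in>vertex_pairs N. ratio f e (G e))" for f and G :: graph
  define s where "s = (\<lambda>(i, j). if b i \<and> b j then 2 * q else q)"
  have \<rho>: "0 \<le> \<rho>" using q by (simp add: \<rho>_def)
  have r0: "0 \<le> r v" for v using q by (simp add: r_def)
  have ratio0: "0 \<le> ratio f e v" for f e v using r0 by (simp add: ratio_def)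
  have s01: "0 \<le> s e" "s e \<le> 1" for e using q by (auto simp: s_def split: prod.split)
  show ?thesis
    unfolding \<beta>_def s_def[symmetric]
  proof (rule second_moment_tv[where \<Lambda> = \<Lambda>])
    show "finite (set_pmf (vertex_map_given N n C b))" using C by (rule finite_vertex_map_given)
    show "finite (set_pmf (edge_product N s))" by (rule finite_edge_product)
    show "0 \<le> \<epsilon>" using \<rho> by (simp add: \<epsilon>_def)
    show "0 < t" by fact
    show "0 \<le> \<Lambda> f G" for f G unfolding \<Lambda>_def using ratio0 by (intro prod_nonneg) auto
  next
    fix f and h :: "graph \<Rightarrow> real"
    show "expect (edge_product N s) (\<lambda>x. \<Lambda> f x * h x)
      = expect (edge_product N (\<lambda>(i, j). if b i \<and> b j \<and> f i \<noteq> f j then 2 * q else q)) h"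
      unfolding \<Lambda>_def edge_product_def
    proof (rule expect_change_of_measure)
      fix e v
      show "pmf (bernoulli_pmf (s e)) v * ratio f e v =
        pmf (bernoulli_pmf (case e of (i, j) \<Rightarrow> if b i \<and> b j \<and> f i \<noteq> f j then 2 * q else q)) v"
        using q by (cases e; cases v) (auto simp: s_def ratio_def r_def collides_def)
    qed (auto intro: finite_subset[of _ UNIV])
  next
    fix f' assume f': "f' \<in> set_pmf (vertex_map_given N n C b)" and good: "load_le N n L f'"
    let ?B = "{v \<in> {..<N}. b v}"
    have fin: "finite C" using C(1) finite_subset by blast
    have pair: "expect (edge_product N s) (\<lambda>G. \<Lambda> f G * \<Lambda> f' G)
      = (1 + \<rho>) ^ card {e \<in> vertex_pairs N. collides b f e \<and> collides b f' e}" for f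
    proof -
      have "expect (edge_product N s) (\<lambda>G. \<Lambda> f G * \<Lambda> f' G)
        = (\<Prod>e\<in>vertex_pairs N. expect (bernoulli_pmf (s e)) (\<lambda>v. ratio f e v * ratio f' e v))"
        unfolding edge_product_def \<Lambda>_def prod.distrib[symmetric] using ratio0
        by (intro expectation_prod_Pi_pmf) (auto intro!: integrable_measure_pmf_finite intro: finite_subset[of _ UNIV])
      \<comment> \<open>A pair collapsed by only one of the partitions contributes the mean of a
        likelihood ratio, which is 1.\<close>
      also have "\<dots> = (\<Prod>e\<in>vertex_pairs N. if collides b f e \<and> collides b f' e then 1 + \<rho> else 1)"
      proof (intro prod.cong refl)
        fix e
        have "s e = 2 * q" if "collides b f e \<or> collides b f' e"
          using that by (auto simp: s_def collides_def split: prod.splits)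
        then show "expect (bernoulli_pmf (s e)) (\<lambda>v. ratio f e v * ratio f' e v)
          = (if collides b f e \<and> collides b f' e then 1 + \<rho> else 1)"
          using q s01[of e] by (auto simp: ratio_def r_def \<rho>_def divide_simps) (auto simp: algebra_simps)
      qed
      also have "\<dots> = (1 + \<rho>) ^ card {e \<in> vertex_pairs N. collides b f e \<and> collides b f' e}"
        by (rule prod_if_one) simp
      finally show ?thesis .
    qed
    have fibre: "card {w \<in> {..<N}. b w \<and> f' w = c} \<le> L" if "c < n" for c
    proof -
      have "card {w \<in> {..<N}. b w \<and> f' w = c} \<le> card {w \<in> {..<N}. f' w = c}"
        by (intro card_mono) auto
      then show ?thesis using good that by (auto simp: load_le_def)
    qed
    \<comment> \<open>The planted vertices fill only the blocks in \<open>C\<close>. The factor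
      \<open>card C\<close> cancels the collision probability \<open>1 / card C\<close>, so the
      final bound does not depend on the clique size.\<close>
    have B: "card ?B \<le> card C * L"
    proof -
      have eq: "?B = (\<Union>c\<in>C. {w \<in> {..<N}. b w \<and> f' w = c})"
        using vertex_map_given_set(1)[OF C f'] by blast
      have "card ?B \<le> (\<Sum>c\<in>C. card {w \<in> {..<N}. b w \<and> f' w = c})"
        unfolding eq by (rule card_UN_le[OF fin])
      also have "\<dots> \<le> (\<Sum>c\<in>C. L)" using C(1) by (intro sum_mono fibre) auto
      finally show ?thesis by simp
    qed
    let ?x = "L * (\<rho> * (1 + \<rho>) ^ L) / card C"
    have x: "0 \<le> ?x" using \<rho> by simp
    have "expect (vertex_map_given N n C b) (\<lambda>f. expect (edge_product N s) (\<lambda>G. \<Lambda> f G * \<Lambda> f' G))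
      \<le> (1 + ?x) ^ card {v \<in> {..<N}. b v}"
      unfolding pair vertex_map_given_def
    proof (rule collision_moment)
      show "finite (set_pmf (pmf_of_set ({..<n} - C)))"
        using complement_nonempty[OF C(1,3)] by simp
      show "card {w \<in> {..<N}. b w \<and> f' w = f' v} \<le> L" if "v < N" "b v" for v
        using that vertex_map_given_set[OF C f'] by (intro fibre) auto
    qed (use C fin \<rho> in auto)
    also have "\<dots> \<le> (1 + ?x) ^ (card C * L)" using B x by (intro power_increasing) auto
    also have "\<dots> \<le> exp ?x ^ (card C * L)"
      using x by (intro power_mono exp_ge_add_one_self) auto
    also have "\<dots> = exp (card C * L * ?x)" by (simp add: exp_of_nat_mult[symmetric])
    also have "card C * L * ?x = L\<^sup>2 * (\<rho> * (1 + \<rho>) ^ L)"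
      using C(2) by (simp add: power2_eq_square)
    finally show "expect (vertex_map_given N n C b)
        (\<lambda>f. expect (edge_product N s) (\<lambda>G. \<Lambda> f G * \<Lambda> f' G)) \<le> 1 + \<epsilon>"
      by (simp add: \<epsilon>_def)
  qed
qed

lemma planted_dense_subgraph_edge_product:
  "planted_dense_subgraph N K p q =
    Pi_pmf {..<N} False (\<lambda>_. bernoulli_pmf (real K / real N)) \<bind>
      (\<lambda>b. edge_product N (\<lambda>(i, j). if b i \<and> b j then p else q))"
  by (simp add: planted_dense_subgraph_def random_vertex_set_def bind_map_pmf edge_product_def case_prod_unfold)

text \<open>The bound for a fixed planted set is affine in the conditional overload probability, so
  averaging over the planted set replaces it by the unconditional one.\<close>

lemma vertex_map_blocks_tv:
  fixes q t \<rho> \<epsilon> \<beta> :: real and L N n :: nat and C :: "nat set"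
  assumes C: "C \<subseteq> {..<n}" "0 < card C" "card C < n"
    and q: "0 < q" "q < 1 / 2" and t: "0 < t" and K: "real K / real N = card C / n"
  defines "\<rho> \<equiv> q / (2 * (1 - 2 * q))"
  defines "\<epsilon> \<equiv> exp (L\<^sup>2 * (\<rho> * (1 + \<rho>) ^ L)) - 1"
  defines "\<beta> \<equiv> measure_pmf.prob (vertex_map N n) {f. \<not> load_le N n L f}"
  shows "tv_le
    (vertex_map N n \<bind> (\<lambda>f. edge_product N
       (\<lambda>(i, j). if f i \<in> C \<and> f j \<in> C \<and> f i \<noteq> f j then 2 * q else q)))
    (planted_dense_subgraph N K (2 * q) q)
    (\<beta> + ((\<epsilon> + 2 * \<beta>) / t + t) / 2)"
proof -
  define S where "S = Pi_pmf {..<N} False (\<lambda>_. bernoulli_pmf (card C / n))"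
  have fin: "finite (set_pmf S)" unfolding S_def
    by (intro finite_set_Pi_pmf) (auto intro: finite_subset[of _ UNIV])
  let ?\<beta> = "\<lambda>b. measure_pmf.prob (vertex_map_given N n C b) {f. \<not> load_le N n L f}"
  have 1: "vertex_map N n \<bind> (\<lambda>f. edge_product N
       (\<lambda>(i, j). if f i \<in> C \<and> f j \<in> C \<and> f i \<noteq> f j then 2 * q else q))
    = S \<bind> (\<lambda>b. vertex_map_given N n C b \<bind>
      (\<lambda>f. edge_product N (\<lambda>(i, j). if b i \<and> b j \<and> f i \<noteq> f j then 2 * q else q)))"
    unfolding vertex_map_bind[OF C] S_def[symmetric] bind_assoc_pmf
  proof (intro bind_pmf_cong refl)
    fix b f assume "f \<in> set_pmf (vertex_map_given N n C b)"
    note * = vertex_map_given_set(1)[OF C this]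
    show "edge_product N (\<lambda>(i, j). if f i \<in> C \<and> f j \<in> C \<and> f i \<noteq> f j then 2 * q else q)
      = edge_product N (\<lambda>(i, j). if b i \<and> b j \<and> f i \<noteq> f j then 2 * q else q)"
      unfolding edge_product_def
      by (intro Pi_pmf_cong refl) (auto simp: vertex_pairs_def *)
  qed
  have 2: "planted_dense_subgraph N K (2 * q) q
    = S \<bind> (\<lambda>b. edge_product N (\<lambda>(i, j). if b i \<and> b j then 2 * q else q))"
    by (simp add: planted_dense_subgraph_edge_product K S_def)
  have "\<beta> = expect S ?\<beta>"
    unfolding \<beta>_def vertex_map_bind[OF C] S_def[symmetric] prob_eq_expect
    by (rule expect_bind) auto
  then have "expect S (\<lambda>b. ?\<beta> b + ((\<epsilon> + 2 * ?\<beta> b) / t + t) / 2) = \<beta> + ((\<epsilon> + 2 * \<beta>) / t + t) / 2"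
  proof -
    note [simp] = integrable_measure_pmf_finite[OF fin]
    have "expect S (\<lambda>b. ?\<beta> b + ((\<epsilon> + 2 * ?\<beta> b) / t + t) / 2)
      = expect S (\<lambda>b. (1 + 1 / t) * ?\<beta> b + (\<epsilon> / t + t) / 2)"
      using t by (intro Bochner_Integration.integral_cong refl) (simp add: field_simps)
    also have "\<dots> = (1 + 1 / t) * expect S ?\<beta> + (\<epsilon> / t + t) / 2" by simp
    also have "\<dots> = expect S ?\<beta> + ((\<epsilon> + 2 * expect S ?\<beta>) / t + t) / 2"
      using t by (simp add: field_simps)
    finally show ?thesis using \<open>\<beta> = expect S ?\<beta>\<close> by simp
  qed
  moreover have "tv_le
    (vertex_map N n \<bind> (\<lambda>f. edge_product N
       (\<lambda>(i, j). if f i \<in> C \<and> f j \<in> C \<and> f i \<noteq> f j then 2 * q else q)))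
    (planted_dense_subgraph N K (2 * q) q)
    (expect S (\<lambda>b. ?\<beta> b + ((\<epsilon> + 2 * ?\<beta> b) / t + t) / 2))"
    unfolding 1 2 \<epsilon>_def \<rho>_def using C q t fin
    by (intro tv_le_bind diagonal_blocks_tv) auto
  ultimately show ?thesis by simp
qed


section \<open>The reduction from planted clique\<close>

definition block_of :: "(nat \<Rightarrow> nat) \<Rightarrow> nat \<times> nat \<Rightarrow> nat \<times> nat" where
  "block_of f = (\<lambda>(i, j). (min (f i) (f j), max (f i) (f j)))"

definition block :: "nat \<Rightarrow> (nat \<Rightarrow> nat) \<Rightarrow> nat \<times> nat \<Rightarrow> (nat \<times> nat) set" where
  "block N f st = {e \<in> vertex_pairs N. block_of f e = st}"

definition block_graph :: "nat \<Rightarrow> (nat \<Rightarrow> nat) \<Rightarrow> real \<Rightarrow> nat \<times> nat \<Rightarrow> graph pmf" where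
  "block_graph N f p st = Pi_pmf (block N f st) False (\<lambda>_. bernoulli_pmf p)"

definition assemble :: "nat \<Rightarrow> (nat \<Rightarrow> nat) \<Rightarrow> (nat \<times> nat \<Rightarrow> graph) \<Rightarrow> graph" where
  "assemble N f H = (\<lambda>e. e \<in> vertex_pairs N \<and> H (block_of f e) e)"

text \<open>Each block is sampled in advance for both values of the old entry, so that
  \<open>H\<close> is independent of \<open>G\<close> and can be frozen into advice.\<close>

definition rewrite_graph ::
    "nat \<Rightarrow> (nat \<Rightarrow> nat) \<Rightarrow> (nat \<times> nat \<Rightarrow> graph \<times> graph) \<Rightarrow> graph \<Rightarrow> graph" where
  "rewrite_graph N f H G = assemble N f (\<lambda>st. if G st then fst (H st) else snd (H st))"

text \<open>Unlike \<open>vertex_pairs n\<close> this contains the diagonal, which indexes the pairs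
  inside one block.\<close>

definition block_indices :: "nat \<Rightarrow> (nat \<times> nat) set" where
  "block_indices n = {(s, t). s \<le> t \<and> t < n}"

lemma finite_block_indices [simp]: "finite (block_indices n)"
  by (rule finite_subset[of _ "{..<n} \<times> {..<n}"]) (auto simp: block_indices_def)

lemma finite_block [simp]: "finite (block N f st)"
  by (simp add: block_def)

lemma finite_block_graph [simp]: "finite (set_pmf (block_graph N f p st))"
  unfolding block_graph_def by (intro finite_set_Pi_pmf) (auto intro: finite_subset[of _ UNIV])

lemma local_rewriting_rewrite_graph: "local_rewriting n N (rewrite_graph N f H)"
  unfolding local_rewriting_def
proof (intro conjI ballI exI allI impI)
  fix G show "rewrite_graph N f H G \<in> graphs N"
    by (simp add: graphs_def rewrite_graph_def assemble_def)
next
  fix G e assume "e \<in> vertex_pairs N"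
  then show "rewrite_graph N f H G e =
    (if G (block_of f e) then fst (H (block_of f e)) e else snd (H (block_of f e)) e)"
    by (simp add: rewrite_graph_def assemble_def)
qed

lemma assemble_block_graphs:
  assumes f: "\<And>v. v < N \<Longrightarrow> f v < n"
  shows "map_pmf (assemble N f) (Pi_pmf (block_indices n) d (\<lambda>st. block_graph N f (r st) st))
    = edge_product N (\<lambda>e. r (block_of f e))"
proof -
  have idx: "block_of f e \<in> block_indices n" if "e \<in> vertex_pairs N" for e
    using that f by (auto simp: vertex_pairs_def block_of_def block_indices_def)
  then have eq: "{e \<in> vertex_pairs N. block_of f e \<in> block_indices n} = vertex_pairs N" by auto
  have "Pi_pmf {e \<in> vertex_pairs N. block_of f e \<in> block_indices n} False (\<lambda>e. bernoulli_pmf (r (block_of f e)))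
    = map_pmf (\<lambda>H e. if e \<in> vertex_pairs N \<and> block_of f e \<in> block_indices n then H (block_of f e) e else False)
      (Pi_pmf (block_indices n) d
        (\<lambda>st. Pi_pmf {e \<in> vertex_pairs N. block_of f e = st} False (\<lambda>e. bernoulli_pmf (r (block_of f e)))))"
    by (rule Pi_pmf_fibres) simp_all
  also have "\<dots> = map_pmf (assemble N f) (Pi_pmf (block_indices n) d (\<lambda>st. block_graph N f (r st) st))"
    unfolding block_graph_def block_def
    by (intro map_pmf_cong Pi_pmf_cong) (use idx in \<open>auto simp: assemble_def fun_eq_iff\<close>)
  finally show ?thesis unfolding eq edge_product_def ..
qed

text \<open>Only one component of each pre-drawn pair is read, so the blocks are independent
  mixtures. On the diagonal there is no old edge and \<open>Q'\<close> is always read.\<close>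

lemma rewrite_graph_law:
  fixes P' Q' :: "nat \<times> nat \<Rightarrow> graph pmf" and g :: "nat \<times> nat \<Rightarrow> bool pmf"
  shows "Pi_pmf (vertex_pairs n) False g \<bind> (\<lambda>G. map_pmf (\<lambda>H. rewrite_graph N f H G)
      (Pi_pmf (block_indices n) d (\<lambda>st. pair_pmf (P' st) (Q' st))))
    = map_pmf (assemble N f) (Pi_pmf (block_indices n) (snd d)
        (\<lambda>st. if st \<in> vertex_pairs n then g st \<bind> (\<lambda>x. if x then P' st else Q' st) else Q' st))"
proof -
  let ?I = "block_indices n"
  \<comment> \<open>Extending the old graph by \<open>False\<close> indexes graph and samples by the
    same set, so that the two products merge coordinatewise.\<close>
  define g' where "g' st = (if st \<in> vertex_pairs n then g st else return_pmf False)" for st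
  have sub: "vertex_pairs n \<subseteq> ?I" by (auto simp: vertex_pairs_def block_indices_def)
  have 1: "Pi_pmf (vertex_pairs n) False g = Pi_pmf ?I False g'"
  proof -
    have "Pi_pmf ?I False g' = Pi_pmf (vertex_pairs n) False g'"
      by (intro Pi_pmf_subset' sub) (auto simp: g'_def)
    also have "\<dots> = Pi_pmf (vertex_pairs n) False g"
      by (intro Pi_pmf_cong refl) (simp add: g'_def)
    finally show ?thesis ..
  qed
  define sel where "sel G st h = (if G st then fst h else snd h)"
    for G :: graph and st and h :: "graph \<times> graph"
  have 2: "map_pmf (sel G st) (pair_pmf (P' st) (Q' st)) = (if G st then P' st else Q' st)" for G st
  proof -
    have "map_pmf (sel G st) (pair_pmf (P' st) (Q' st))
      = (if G st then map_pmf fst (pair_pmf (P' st) (Q' st)) else map_pmf snd (pair_pmf (P' st) (Q' st)))"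
      by (auto simp: sel_def[abs_def])
    then show ?thesis by (simp add: map_fst_pair_pmf map_snd_pair_pmf)
  qed
  have 3: "map_pmf (\<lambda>H. rewrite_graph N f H G) (Pi_pmf ?I d (\<lambda>st. pair_pmf (P' st) (Q' st)))
    = map_pmf (assemble N f) (Pi_pmf ?I (snd d) (\<lambda>st. if G st then P' st else Q' st))"
    if G: "\<And>st. st \<notin> ?I \<Longrightarrow> \<not> G st" for G
  proof -
    have "Pi_pmf ?I (snd d) (\<lambda>st. if G st then P' st else Q' st)
      = Pi_pmf ?I (snd d) (\<lambda>st. map_pmf (sel G st) (pair_pmf (P' st) (Q' st)))"
      by (simp add: 2)
    also have "\<dots> = map_pmf (\<lambda>H st. if st \<in> ?I then sel G st (H st) else snd d)
      (Pi_pmf ?I d (\<lambda>st. pair_pmf (P' st) (Q' st)))"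
      by (rule Pi_pmf_map_dependent) simp
    also have "\<dots> = map_pmf (\<lambda>H st. sel G st (H st)) (Pi_pmf ?I d (\<lambda>st. pair_pmf (P' st) (Q' st)))"
    proof (rule map_pmf_cong[OF refl], rule ext)
      fix H st assume "H \<in> set_pmf (Pi_pmf ?I d (\<lambda>st. pair_pmf (P' st) (Q' st)))"
      then have "st \<notin> ?I \<Longrightarrow> H st = d" using set_Pi_pmf_subset[of ?I d] finite_block_indices by blast
      then show "(if st \<in> ?I then sel G st (H st) else snd d) = sel G st (H st)"
        using G by (auto simp: sel_def)
    qed
    finally show ?thesis
      by (simp add: pmf.map_comp o_def rewrite_graph_def sel_def)
  qed
  have "Pi_pmf (vertex_pairs n) False g \<bind> (\<lambda>G. map_pmf (\<lambda>H. rewrite_graph N f H G)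
      (Pi_pmf ?I d (\<lambda>st. pair_pmf (P' st) (Q' st))))
    = Pi_pmf ?I False g' \<bind> (\<lambda>G. map_pmf (assemble N f)
        (Pi_pmf ?I (snd d) (\<lambda>st. if G st then P' st else Q' st)))"
    unfolding 1
  proof (intro bind_pmf_cong refl 3)
    fix G st assume "G \<in> set_pmf (Pi_pmf ?I False g')" "st \<notin> ?I"
    then show "\<not> G st" using set_Pi_pmf_subset[of ?I False g'] finite_block_indices by blast
  qed
  also have "\<dots> = map_pmf (assemble N f) (Pi_pmf ?I (snd d) (\<lambda>st. g' st \<bind> (\<lambda>x. if x then P' st else Q' st)))"
    by (simp add: Pi_pmf_bind[where d' = False] map_bind_pmf)
  also have "(\<lambda>st. g' st \<bind> (\<lambda>x. if x then P' st else Q' st))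
    = (\<lambda>st. if st \<in> vertex_pairs n then g st \<bind> (\<lambda>x. if x then P' st else Q' st) else Q' st)"
    by (rule ext) (simp add: g'_def bind_return_pmf)
  finally show ?thesis .
qed

text \<open>The ratio \<open>pmf P x / pmf Q x\<close> is at most 2 to the number of present pairs,
  so exceeding \<open>1 / \<gamma>\<close> takes at least \<open>Suc m\<close> of them; a union
  bound over the sets of that size finishes.\<close>

lemma bernoulli_product_deviation:
  fixes q \<gamma> :: real
  assumes E: "finite E" and q: "0 < q" "q < 1 / 2" and \<gamma>: "0 < \<gamma>" "\<gamma> * 2 ^ m \<le> 1"
  defines "P \<equiv> Pi_pmf E False (\<lambda>_. bernoulli_pmf (2 * q))"
    and "Q \<equiv> Pi_pmf E False (\<lambda>_. bernoulli_pmf q)"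
  shows "measure_pmf.prob P {x. pmf Q x < \<gamma> * pmf P x} \<le> (2 * q * card E) ^ Suc m"
proof -
  have fin: "finite (set_pmf P)"
    unfolding P_def using E by (intro finite_set_Pi_pmf) (auto intro: finite_subset[of _ UNIV])
  note [simp] = integrable_measure_pmf_finite[OF fin]
  have ratio: "pmf P x \<le> 2 ^ card {e \<in> E. x e} * pmf Q x" for x
  proof (cases "\<forall>e. e \<notin> E \<longrightarrow> x e = False")
    case True
    have "pmf P x = (\<Prod>e\<in>E. pmf (bernoulli_pmf (2 * q)) (x e))"
      unfolding P_def using E True by (intro pmf_Pi') auto
    also have "\<dots> \<le> (\<Prod>e\<in>E. (if x e then 2 else 1) * pmf (bernoulli_pmf q) (x e))"
      using q by (intro prod_mono) auto
    also have "\<dots> = 2 ^ card {e \<in> E. x e} * (\<Prod>e\<in>E. pmf (bernoulli_pmf q) (x e))"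
      using E by (simp only: prod.distrib prod_if_one)
    also have "(\<Prod>e\<in>E. pmf (bernoulli_pmf q) (x e)) = pmf Q x"
      unfolding Q_def using E True by (intro pmf_Pi'[symmetric]) auto
    finally show ?thesis .
  next
    case False
    then have "pmf P x = 0" unfolding P_def using E by (intro pmf_Pi_outside) auto
    then show ?thesis by simp
  qed
  define \<T> where "\<T> = {T. T \<subseteq> E \<and> card T = Suc m}"
  have \<T>: "finite \<T>" using E by (simp add: \<T>_def)
  let ?h = "\<lambda>T e v. if e \<in> T then of_bool v else (1 :: real)"
  have nonneg: "0 \<le> (\<Prod>e\<in>E. ?h T e (x e))" for T x by (intro prod_nonneg) auto
  have "measure_pmf.prob P {x. pmf Q x < \<gamma> * pmf P x} \<le> expect P (\<lambda>x. \<Sum>T\<in>\<T>. \<Prod>e\<in>E. ?h T e (x e))"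
    unfolding prob_eq_expect
  proof (intro integral_mono)
    fix x
    show "of_bool (x \<in> {x. pmf Q x < \<gamma> * pmf P x}) \<le> (\<Sum>T\<in>\<T>. \<Prod>e\<in>E. ?h T e (x e))"
    proof (cases "pmf Q x < \<gamma> * pmf P x")
      case True
      have "\<not> card {e \<in> E. x e} \<le> m"
      proof
        assume "card {e \<in> E. x e} \<le> m"
        then have "\<gamma> * 2 ^ card {e \<in> E. x e} \<le> \<gamma> * 2 ^ m"
          using \<gamma> by (intro mult_left_mono power_increasing) auto
        also have "\<dots> \<le> 1" by (rule \<gamma>(2))
        finally have "\<gamma> * 2 ^ card {e \<in> E. x e} * pmf Q x \<le> 1 * pmf Q x"
          by (intro mult_right_mono) auto
        moreover have "\<gamma> * pmf P x \<le> \<gamma> * (2 ^ card {e \<in> E. x e} * pmf Q x)"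
          using \<gamma> ratio by (intro mult_left_mono) auto
        ultimately show False using True by (simp add: mult.assoc)
      qed
      then obtain T where T: "T \<subseteq> {e \<in> E. x e}" "card T = Suc m"
        by (meson not_less_eq_eq obtain_subset_with_card_n)
      then have "(1 :: real) = (\<Prod>e\<in>E. ?h T e (x e))" by (intro prod.neutral[symmetric]) auto
      also have "\<dots> \<le> (\<Sum>T\<in>\<T>. \<Prod>e\<in>E. ?h T e (x e))"
        by (rule member_le_sum) (use T \<T> in \<open>auto simp: \<T>_def nonneg\<close>)
      finally show ?thesis by simp
    qed (simp add: sum_nonneg nonneg)
  qed auto
  also have "\<dots> = (\<Sum>T\<in>\<T>. expect P (\<lambda>x. \<Prod>e\<in>E. ?h T e (x e)))"
    by simp
  also have "\<dots> = (\<Sum>T\<in>\<T>. (2 * q) ^ Suc m)"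
  proof (intro sum.cong refl)
    fix T assume T: "T \<in> \<T>"
    have "expect P (\<lambda>x. \<Prod>e\<in>E. ?h T e (x e)) = (\<Prod>e\<in>E. expect (bernoulli_pmf (2 * q)) (?h T e))"
      unfolding P_def using E
      by (intro expectation_prod_Pi_pmf)
        (auto intro!: integrable_measure_pmf_finite intro: finite_subset[of _ UNIV])
    also have "\<dots> = (\<Prod>e\<in>E. if e \<in> T then 2 * q else 1)" using q by (intro prod.cong) auto
    also have "\<dots> = (2 * q) ^ card {e \<in> E. e \<in> T}" using E by (rule prod_if_one)
    also have "{e \<in> E. e \<in> T} = T" using T by (auto simp: \<T>_def)
    finally show "expect P (\<lambda>x. \<Prod>e\<in>E. ?h T e (x e)) = (2 * q) ^ Suc m" using T by (simp add: \<T>_def)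
  qed
  also have "\<dots> = (card E choose Suc m) * (2 * q) ^ Suc m"
    using E by (simp add: \<T>_def n_subsets)
  also have "\<dots> \<le> real (card E ^ Suc m) * (2 * q) ^ Suc m"
  proof (intro mult_right_mono)
    have "card E choose Suc m \<le> card E ^ Suc m"
      by (cases "Suc m \<le> card E") (simp_all only: binomial_le_pow binomial_eq_0 not_le zero_le)
    then show "real (card E choose Suc m) \<le> real (card E ^ Suc m)" by (rule of_nat_mono)
  qed (use q in simp)
  finally show ?thesis by (simp only: of_nat_power power_mult_distrib mult_ac)
qed

lemma card_block_le:
  assumes f: "load_le N n L f" and st: "s < t" "t < n"
  shows "card (block N f (s, t)) \<le> L\<^sup>2"
proof -
  let ?A = "{v \<in> {..<N}. f v = s}" and ?B = "{v \<in> {..<N}. f v = t}"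
  \<comment> \<open>Orients each pair so that the endpoint in block \<open>s\<close> comes first;
    the pair is recovered from \<open>i < j\<close>.\<close>
  let ?\<phi> = "\<lambda>(i, j). if f i = s then (i, j) else (j, i)"
  have "card (block N f (s, t)) \<le> card (?A \<times> ?B)"
  proof (rule card_inj_on_le)
    show "inj_on ?\<phi> (block N f (s, t))"
      by (auto simp: inj_on_def block_def vertex_pairs_def split: if_splits)
    show "?\<phi> ` block N f (s, t) \<subseteq> ?A \<times> ?B"
      using st by (auto simp: block_def vertex_pairs_def block_of_def min_def max_def split: if_splits)
  qed simp
  also have "\<dots> = card ?A * card ?B" by (rule card_cartesian_product)
  also have "\<dots> \<le> L * L" using f st unfolding load_le_def by (intro mult_mono) auto
  finally show ?thesis by (simp add: power2_eq_square)
qed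

definition clique_graph :: "nat \<Rightarrow> real \<Rightarrow> nat set \<Rightarrow> graph pmf" where
  "clique_graph n \<gamma> C = Pi_pmf (vertex_pairs n) False
     (\<lambda>(s, t). if s \<in> C \<and> t \<in> C then return_pmf True else bernoulli_pmf \<gamma>)"

text \<open>Adding the clique acts on each entry separately, so for a fixed location the entries
  stay independent. Graph and location may be drawn in either order.\<close>

lemma planted_clique_clique_graph:
  "planted_clique n k \<gamma> = pmf_of_set {C. C \<subseteq> {..<n} \<and> card C = k} \<bind> clique_graph n \<gamma>"
proof -
  define h where "h C e x \<longleftrightarrow> x \<or> fst e \<in> C \<and> snd e \<in> C" for C and e :: "nat \<times> nat" and x
  have "clique_graph n \<gamma> C = erdos_renyi n \<gamma> \<bind> (\<lambda>G.
      return_pmf (\<lambda>(i, j). G (i, j) \<or> ((i, j) \<in> vertex_pairs n \<and> i \<in> C \<and> j \<in> C)))" for C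
  proof -
    have "map_pmf (h C e) (bernoulli_pmf \<gamma>)
      = (if fst e \<in> C \<and> snd e \<in> C then return_pmf True else bernoulli_pmf \<gamma>)" for e
      by (auto simp: h_def[abs_def] map_pmf_const)
    then have "clique_graph n \<gamma> C = Pi_pmf (vertex_pairs n) False (\<lambda>e. map_pmf (h C e) (bernoulli_pmf \<gamma>))"
      by (simp add: clique_graph_def case_prod_unfold)
    also have "\<dots> = map_pmf (\<lambda>G e. if e \<in> vertex_pairs n then h C e (G e) else False) (erdos_renyi n \<gamma>)"
      unfolding erdos_renyi_def by (rule Pi_pmf_map_dependent) simp
    also have "\<dots> = map_pmf (\<lambda>G (i, j). G (i, j) \<or> ((i, j) \<in> vertex_pairs n \<and> i \<in> C \<and> j \<in> C)) (erdos_renyi n \<gamma>)"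
    proof (intro map_pmf_cong refl ext)
      fix G e assume "G \<in> set_pmf (erdos_renyi n \<gamma>)"
      then have "e \<notin> vertex_pairs n \<Longrightarrow> \<not> G e"
        using set_Pi_pmf_subset[of "vertex_pairs n" False "\<lambda>_. bernoulli_pmf \<gamma>"]
        unfolding erdos_renyi_def using finite_vertex_pairs by blast
      then show "(if e \<in> vertex_pairs n then h C e (G e) else False) =
          (case e of (i, j) \<Rightarrow> G (i, j) \<or> ((i, j) \<in> vertex_pairs n \<and> i \<in> C \<and> j \<in> C))"
        by (cases e) (auto simp: h_def)
    qed
    finally show ?thesis by (simp add: map_pmf_def)
  qed
  then have "clique_graph n \<gamma> = (\<lambda>C. erdos_renyi n \<gamma> \<bind> (\<lambda>G.
      return_pmf (\<lambda>(i, j). G (i, j) \<or> ((i, j) \<in> vertex_pairs n \<and> i \<in> C \<and> j \<in> C))))"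
    by (rule ext)
  then show ?thesis unfolding planted_clique_def by (simp add: bind_commute_pmf[of "erdos_renyi n \<gamma>"])
qed

text \<open>For a fixed partition, \<open>A\<close> is the law of the block samples. It is chosen
  before \<open>C\<close>, as the location of the clique is unknown to the reduction. Only the
  off-diagonal blocks inside \<open>C\<close> deviate from their target, at most
  \<open>(card C)\<^sup>2\<close> in number.\<close>

lemma block_rewriting:
  fixes q \<gamma> :: real
  assumes \<gamma>: "0 < \<gamma>" "\<gamma> < 1" "\<gamma> * 2 ^ m \<le> 1" and q: "0 < q" "q < 1 / 2"
    and f: "\<And>v. v < N \<Longrightarrow> f v < n"
  obtains A where "finite (set_pmf A)"
    "erdos_renyi n \<gamma> \<bind> (\<lambda>G. map_pmf (\<lambda>H. rewrite_graph N f H G) A) = erdos_renyi N q"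
    "\<And>C L. C \<subseteq> {..<n} \<Longrightarrow> load_le N n L f \<Longrightarrow>
      tv_le (clique_graph n \<gamma> C \<bind> (\<lambda>G. map_pmf (\<lambda>H. rewrite_graph N f H G) A))
        (edge_product N (\<lambda>(i, j). if f i \<in> C \<and> f j \<in> C \<and> f i \<noteq> f j then 2 * q else q))
        ((card C)\<^sup>2 * (2 * q * L\<^sup>2) ^ Suc m)"
proof -
  let ?P = "block_graph N f (2 * q)" and ?Q = "block_graph N f q"
  let ?R = "\<lambda>st (P', Q'). bernoulli_pmf \<gamma> \<bind> (\<lambda>b. if b then P' else Q') = ?Q st \<and>
    tv_le P' (?P st) (measure_pmf.prob (?P st) {x. pmf (?Q st) x < \<gamma> * pmf (?P st) x}) \<and>
    set_pmf P' \<subseteq> set_pmf (?Q st) \<and> set_pmf Q' \<subseteq> set_pmf (?Q st)"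
  have "\<forall>st. \<exists>PQ. ?R st PQ"
  proof
    fix st
    show "\<exists>PQ. ?R st PQ"
      by (rule mixture_decomposition[OF \<gamma>(1,2), of "?P st" "?Q st"]) auto
  qed
  from choice[OF this] obtain PQ where PQ: "\<forall>st. ?R st (PQ st)" ..
  define P' Q0 where "P' st = fst (PQ st)" and "Q0 st = snd (PQ st)" for st
  have P': "bernoulli_pmf \<gamma> \<bind> (\<lambda>b. if b then P' st else Q0 st) = ?Q st"
    "tv_le (P' st) (?P st) (measure_pmf.prob (?P st) {x. pmf (?Q st) x < \<gamma> * pmf (?P st) x})"
    "set_pmf (P' st) \<subseteq> set_pmf (?Q st)" "set_pmf (Q0 st) \<subseteq> set_pmf (?Q st)" for st
    unfolding P'_def Q0_def using PQ[rule_format, of st] by (simp_all add: case_prod_unfold)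
  \<comment> \<open>Diagonal blocks have no old entry to mix over, so they get density
    \<open>q\<close> directly.\<close>
  define Q' where "Q' st = (if st \<in> vertex_pairs n then Q0 st else ?Q st)" for st
  have mix: "bernoulli_pmf \<gamma> \<bind> (\<lambda>b. if b then P' st else Q' st) = ?Q st"
    if "st \<in> vertex_pairs n" for st
  proof -
    have "Q' st = Q0 st" using that by (simp add: Q'_def)
    then show ?thesis using P'(1)[of st] by (simp only:)
  qed
  define d where "d = ((\<lambda>_. False, \<lambda>_. False) :: graph \<times> graph)"
  define A where "A = Pi_pmf (block_indices n) d (\<lambda>st. pair_pmf (P' st) (Q' st))"
  have fin_P': "finite (set_pmf (P' st))" "finite (set_pmf (Q' st))" for st
    using finite_subset[OF P'(3)] finite_subset[OF P'(4)] by (auto simp: Q'_def)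
  have "finite (set_pmf A)" unfolding A_def using fin_P' by (intro finite_set_Pi_pmf) auto
  moreover have "erdos_renyi n \<gamma> \<bind> (\<lambda>G. map_pmf (\<lambda>H. rewrite_graph N f H G) A) = erdos_renyi N q"
  proof -
    have "erdos_renyi n \<gamma> \<bind> (\<lambda>G. map_pmf (\<lambda>H. rewrite_graph N f H G) A)
      = map_pmf (assemble N f) (Pi_pmf (block_indices n) (snd d) ?Q)"
      unfolding erdos_renyi_def A_def rewrite_graph_law
      by (intro map_pmf_cong Pi_pmf_cong refl) (auto simp: mix Q'_def)
    also have "\<dots> = edge_product N (\<lambda>e. q)"
      using f by (rule assemble_block_graphs)
    finally show ?thesis by (simp add: edge_product_def erdos_renyi_def)
  qed
  moreover have "tv_le (clique_graph n \<gamma> C \<bind> (\<lambda>G. map_pmf (\<lambda>H. rewrite_graph N f H G) A))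
      (edge_product N (\<lambda>(i, j). if f i \<in> C \<and> f j \<in> C \<and> f i \<noteq> f j then 2 * q else q))
      ((card C)\<^sup>2 * (2 * q * L\<^sup>2) ^ Suc m)"
    if C: "C \<subseteq> {..<n}" and L: "load_le N n L f" for C L
  proof -
    define K where "K = {(s, t). s \<in> C \<and> t \<in> C \<and> s < t}"
    have K: "K \<subseteq> vertex_pairs n" using C by (auto simp: K_def vertex_pairs_def)
    let ?\<delta> = "(2 * q * L\<^sup>2) ^ Suc m"
    have law: "clique_graph n \<gamma> C \<bind> (\<lambda>G. map_pmf (\<lambda>H. rewrite_graph N f H G) A)
      = map_pmf (assemble N f) (Pi_pmf (block_indices n) (snd d) (\<lambda>st. if st \<in> K then P' st else ?Q st))"
      unfolding clique_graph_def A_def rewrite_graph_law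
      by (intro map_pmf_cong Pi_pmf_cong refl)
        (use K in \<open>auto simp: mix bind_return_pmf K_def vertex_pairs_def Q'_def\<close>)
    have target: "edge_product N (\<lambda>(i, j). if f i \<in> C \<and> f j \<in> C \<and> f i \<noteq> f j then 2 * q else q)
      = map_pmf (assemble N f) (Pi_pmf (block_indices n) (snd d)
          (\<lambda>st. block_graph N f (if st \<in> K then 2 * q else q) st))"
    proof -
      have "map_pmf (assemble N f) (Pi_pmf (block_indices n) (snd d)
          (\<lambda>st. block_graph N f (if st \<in> K then 2 * q else q) st))
        = edge_product N (\<lambda>e. if block_of f e \<in> K then 2 * q else q)"
        using f by (rule assemble_block_graphs)
      also have "\<dots> = edge_product N (\<lambda>(i, j). if f i \<in> C \<and> f j \<in> C \<and> f i \<noteq> f j then 2 * q else q)"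
      proof -
        have "block_of f (i, j) \<in> K \<longleftrightarrow> f i \<in> C \<and> f j \<in> C \<and> f i \<noteq> f j" for i j
          by (cases "f i \<le> f j") (auto simp: K_def block_of_def)
        then show ?thesis unfolding edge_product_def by (intro Pi_pmf_cong refl) auto
      qed
      finally show ?thesis ..
    qed
    have tv: "tv_le (Pi_pmf (block_indices n) (snd d) (\<lambda>st. if st \<in> K then P' st else ?Q st))
      (Pi_pmf (block_indices n) (snd d) (\<lambda>st. block_graph N f (if st \<in> K then 2 * q else q) st))
      (\<Sum>st\<in>block_indices n. if st \<in> K then ?\<delta> else 0)"
    proof (rule tv_le_Pi_pmf)
      fix st
      show "tv_le (if st \<in> K then P' st else ?Q st) (block_graph N f (if st \<in> K then 2 * q else q) st)
        (if st \<in> K then ?\<delta> else 0)"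
      proof (cases "st \<in> K")
        case True
        obtain s t where st: "st = (s, t)" "s < t" "t < n" using True K by (auto simp: K_def vertex_pairs_def)
        have "measure_pmf.prob (?P st) {x. pmf (?Q st) x < \<gamma> * pmf (?P st) x}
          \<le> (2 * q * card (block N f st)) ^ Suc m"
          unfolding block_graph_def using q \<gamma> by (intro bernoulli_product_deviation) auto
        also have "\<dots> \<le> ?\<delta>"
          using card_block_le[OF L st(2,3)] q st(1)
          by (intro power_mono mult_left_mono) (simp_all flip: of_nat_power)
        finally show ?thesis using True by (auto intro: tv_le_mono[OF P'(2)])
      qed (simp add: tv_le_refl)
      show "finite (set_pmf (if st \<in> K then P' st else ?Q st)) \<and>
        finite (set_pmf (block_graph N f (if st \<in> K then 2 * q else q) st))"
        using fin_P' by auto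
    qed simp
    have total: "(\<Sum>st\<in>block_indices n. if st \<in> K then ?\<delta> else 0) \<le> (card C)\<^sup>2 * ?\<delta>"
    proof -
      have fin: "finite C" using C finite_subset by blast
      have "K \<subseteq> C \<times> C" by (auto simp: K_def)
      then have "card {st \<in> block_indices n. st \<in> K} \<le> card (C \<times> C)"
        using fin by (intro card_mono) auto
      then have "real (card {st \<in> block_indices n. st \<in> K}) \<le> (card C)\<^sup>2"
        by (simp add: card_cartesian_product power2_eq_square flip: of_nat_mult)
      then have "card {st \<in> block_indices n. st \<in> K} * ?\<delta> \<le> (card C)\<^sup>2 * ?\<delta>"
        using q by (intro mult_right_mono) auto
      then show ?thesis by (subst sum.inter_filter[symmetric]) simp_all
    qed
    show ?thesis unfolding law target by (rule tv_le_mono[OF tv_le_map[OF tv]]) (use total in simp)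
  qed
  ultimately show thesis by (rule that)
qed

section \<open>Averaging over partitions and fixing the advice\<close>

lemma vertex_map_set:
  assumes "0 < n" "f \<in> set_pmf (vertex_map N n)" "v < N" shows "f v < n"
  using assms by (auto simp: vertex_map_def set_Pi_pmf PiE_dflt_def lessThan_nonempty)

text \<open>The sum of the two errors is linear in the law of the rewriting, so one rewriting is at
  least as good as the average for both errors taken together.\<close>

lemma error_sum_average:
  assumes D: "finite (set_pmf D)"
  obtains F where "F \<in> set_pmf D"
    "error_sum M0 M1 (\<lambda>G. \<phi> (F G))
      \<le> error_sum (M0 \<bind> (\<lambda>G. map_pmf (\<lambda>F. F G) D)) (M1 \<bind> (\<lambda>G. map_pmf (\<lambda>F. F G) D)) \<phi>"
proof -
  have swap: "expect D (\<lambda>F. pmf (M \<bind> (\<lambda>G. \<phi> (F G))) x)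
    = pmf ((M \<bind> (\<lambda>G. map_pmf (\<lambda>F. F G) D)) \<bind> \<phi>) x" for M :: "graph pmf" and x
    unfolding pmf_bind[of D, symmetric] bind_assoc_pmf bind_map_pmf
    by (subst bind_commute_pmf) (rule refl)
  obtain F where F: "F \<in> set_pmf D"
    "error_sum M0 M1 (\<lambda>G. \<phi> (F G)) \<le> expect D (\<lambda>F. error_sum M0 M1 (\<lambda>G. \<phi> (F G)))"
    using expect_attained[OF D, where g = "\<lambda>F. error_sum M0 M1 (\<lambda>G. \<phi> (F G))"] .
  have "expect D (\<lambda>F. error_sum M0 M1 (\<lambda>G. \<phi> (F G)))
    = expect D (\<lambda>F. pmf (M0 \<bind> (\<lambda>G. \<phi> (F G))) True) + expect D (\<lambda>F. pmf (M1 \<bind> (\<lambda>G. \<phi> (F G))) False)"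
    unfolding error_sum_def using D
    by (intro Bochner_Integration.integral_add integrable_measure_pmf_finite)
  also have "\<dots> = error_sum (M0 \<bind> (\<lambda>G. map_pmf (\<lambda>F. F G) D)) (M1 \<bind> (\<lambda>G. map_pmf (\<lambda>F. F G) D)) \<phi>"
    by (simp add: swap error_sum_def)
  finally show thesis using F that by auto
qed

lemma error_sum_tv_le:
  fixes \<phi> :: test
  assumes "tv_le M1 M1' d" shows "error_sum M0 M1 \<phi> \<le> error_sum M0 M1' \<phi> + d"
  using tv_leD[OF assms, of "\<lambda>G. pmf (\<phi> G) False"]
  by (simp add: error_sum_def pmf_bind pmf_le_1)

text \<open>In the error, the first \<open>\<beta>\<close> charges overloaded partitions in the
  off-diagonal comparison, the term with \<open>Suc m\<close> is the cost of the clique blocks, and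
  the rest is the cost of the diagonal blocks.\<close>

lemma planted_clique_reduction:
  fixes q t \<gamma> \<rho> \<epsilon> \<beta> :: real and L N n k K m :: nat and \<phi> :: test
  assumes \<gamma>: "0 < \<gamma>" "\<gamma> < 1" "\<gamma> * 2 ^ m \<le> 1" and q: "0 < q" "q < 1 / 2" and t: "0 < t"
    and k: "0 < k" "k < n" and K: "real K / real N = k / n"
  defines "\<rho> \<equiv> q / (2 * (1 - 2 * q))"
  defines "\<epsilon> \<equiv> exp (L\<^sup>2 * (\<rho> * (1 + \<rho>) ^ L)) - 1"
  defines "\<beta> \<equiv> n * ((1 + 1 / n) ^ N / 2 ^ L)"
  obtains F where "local_rewriting n N F"
    "error_sum (erdos_renyi n \<gamma>) (planted_clique n k \<gamma>) (\<lambda>G. \<phi> (F G))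
      \<le> error_sum (erdos_renyi N q) (planted_dense_subgraph N K (2 * q) q) \<phi>
        + (\<beta> + k\<^sup>2 * (2 * q * L\<^sup>2) ^ Suc m + (\<beta> + ((\<epsilon> + 2 * \<beta>) / t + t) / 2))"
proof -
  have n: "0 < n" using k by simp
  let ?V = "vertex_map N n" and ?PDS = "planted_dense_subgraph N K (2 * q) q"
  let ?\<delta> = "k\<^sup>2 * (2 * q * L\<^sup>2) ^ Suc m"
  let ?E = "\<lambda>C f. edge_product N (\<lambda>(i, j). if f i \<in> C \<and> f j \<in> C \<and> f i \<noteq> f j then 2 * q else q)"
  let ?apply = "\<lambda>f A G. map_pmf (\<lambda>H. rewrite_graph N f H G) A"
  define R where "R f A \<longleftrightarrow> finite (set_pmf A) \<and> erdos_renyi n \<gamma> \<bind> ?apply f A = erdos_renyi N q \<and>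
    (\<forall>C. C \<subseteq> {..<n} \<and> load_le N n L f \<longrightarrow>
      tv_le (clique_graph n \<gamma> C \<bind> ?apply f A) (?E C f) ((card C)\<^sup>2 * (2 * q * L\<^sup>2) ^ Suc m))"
    for f A
  have "\<forall>f. \<exists>A. f \<in> set_pmf ?V \<longrightarrow> R f A"
  proof
    fix f
    show "\<exists>A. f \<in> set_pmf ?V \<longrightarrow> R f A"
    proof (cases "f \<in> set_pmf ?V")
      case True
      then have f: "\<And>v. v < N \<Longrightarrow> f v < n" using vertex_map_set[OF n] by blast
      show ?thesis
      proof (rule block_rewriting[OF \<gamma> q, where N = N and n = n and f = f])
        show "f v < n" if "v < N" for v using that by (rule f)
      next
        fix A
        assume "finite (set_pmf A)" "erdos_renyi n \<gamma> \<bind> ?apply f A = erdos_renyi N q"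
          "\<And>C L. C \<subseteq> {..<n} \<Longrightarrow> load_le N n L f \<Longrightarrow>
            tv_le (clique_graph n \<gamma> C \<bind> ?apply f A) (?E C f) ((card C)\<^sup>2 * (2 * q * L\<^sup>2) ^ Suc m)"
        then have "R f A" by (simp add: R_def)
        then show ?thesis by blast
      qed
    qed simp
  qed
  from choice[OF this] obtain A where A: "\<forall>f. f \<in> set_pmf ?V \<longrightarrow> R f (A f)" ..
  define D where "D = ?V \<bind> (\<lambda>f. map_pmf (rewrite_graph N f) (A f))"
  have finV: "finite (set_pmf ?V)" by (rule finite_vertex_map[OF n])
  have finD: "finite (set_pmf D)" using finV A by (auto simp: D_def R_def)
  have law: "M \<bind> (\<lambda>G. map_pmf (\<lambda>F. F G) D) = ?V \<bind> (\<lambda>f. M \<bind> ?apply f (A f))"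
    for M :: "graph pmf"
    unfolding D_def map_bind_pmf pmf.map_comp o_def by (rule bind_commute_pmf)
  have null: "erdos_renyi n \<gamma> \<bind> (\<lambda>G. map_pmf (\<lambda>F. F G) D) = erdos_renyi N q"
  proof -
    have "?V \<bind> (\<lambda>f. erdos_renyi n \<gamma> \<bind> ?apply f (A f)) = ?V \<bind> (\<lambda>f. erdos_renyi N q)"
      using A by (intro bind_pmf_cong refl) (simp add: R_def)
    then show ?thesis unfolding law by simp
  qed
  let ?p = "measure_pmf.prob ?V {f. \<not> load_le N n L f}"
  have p: "?p \<le> \<beta>" unfolding \<beta>_def by (rule overload_prob[OF n])
  have clique: "tv_le (clique_graph n \<gamma> C \<bind> (\<lambda>G. map_pmf (\<lambda>F. F G) D)) ?PDS
      (\<beta> + ?\<delta> + (\<beta> + ((\<epsilon> + 2 * \<beta>) / t + t) / 2))"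
    if C: "C \<subseteq> {..<n}" "card C = k" for C
  proof -
    have blocks: "tv_le (?V \<bind> (\<lambda>f. clique_graph n \<gamma> C \<bind> ?apply f (A f))) (?V \<bind> ?E C)
      (expect ?V (\<lambda>f. of_bool (f \<in> {f. \<not> load_le N n L f}) + ?\<delta>))"
    proof (rule tv_le_bind)
      fix f assume f: "f \<in> set_pmf ?V"
      show "tv_le (clique_graph n \<gamma> C \<bind> ?apply f (A f)) (?E C f)
        (of_bool (f \<in> {f. \<not> load_le N n L f}) + ?\<delta>)"
      proof (cases "load_le N n L f")
        case True
        have "R f (A f)" using A f by blast
        then have "tv_le (clique_graph n \<gamma> C \<bind> ?apply f (A f)) (?E C f) ((card C)\<^sup>2 * (2 * q * L\<^sup>2) ^ Suc m)"
          using C True unfolding R_def by blast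
        then show ?thesis using C True by simp
      next
        case False
        have "0 \<le> ?\<delta>" using q by simp
        with False show ?thesis by (intro tv_le_mono[OF tv_le_one]) simp
      qed
    qed (rule finV)
    have mean: "expect ?V (\<lambda>f. of_bool (f \<in> {f. \<not> load_le N n L f}) + ?\<delta>) = ?p + ?\<delta>"
    proof -
      note [simp] = integrable_measure_pmf_finite[OF finV]
      show ?thesis unfolding prob_eq_expect by simp
    qed
    have diagonal: "tv_le (?V \<bind> ?E C) ?PDS (?p + ((\<epsilon> + 2 * ?p) / t + t) / 2)"
      unfolding \<epsilon>_def \<rho>_def using C k q t K by (intro vertex_map_blocks_tv) auto
    have "tv_le (clique_graph n \<gamma> C \<bind> (\<lambda>G. map_pmf (\<lambda>F. F G) D)) ?PDS
      ((?p + ?\<delta>) + (?p + ((\<epsilon> + 2 * ?p) / t + t) / 2))"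
      unfolding law by (rule tv_le_trans[OF blocks[unfolded mean] diagonal])
    then show ?thesis
    proof (rule tv_le_mono)
      show "(?p + ?\<delta>) + (?p + ((\<epsilon> + 2 * ?p) / t + t) / 2)
        \<le> \<beta> + ?\<delta> + (\<beta> + ((\<epsilon> + 2 * \<beta>) / t + t) / 2)"
        using p t by (intro add_mono divide_right_mono mult_left_mono order_refl) auto
    qed
  qed
  define \<C> where "\<C> = {C. C \<subseteq> {..<n} \<and> card C = k}"
  have \<C>: "finite \<C>" "\<C> \<noteq> {}"
  proof -
    have "\<C> \<subseteq> Pow {..<n}" by (auto simp: \<C>_def)
    then show "finite \<C>" by (rule finite_subset) simp
    have "{..<k} \<in> \<C>" using k by (auto simp: \<C>_def)
    then show "\<C> \<noteq> {}" by blast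
  qed
  have "tv_le (pmf_of_set \<C> \<bind> (\<lambda>C. clique_graph n \<gamma> C \<bind> (\<lambda>G. map_pmf (\<lambda>F. F G) D)))
      (pmf_of_set \<C> \<bind> (\<lambda>C. ?PDS)) (\<beta> + ?\<delta> + (\<beta> + ((\<epsilon> + 2 * \<beta>) / t + t) / 2))"
    using \<C> by (intro tv_le_bind_const clique) (auto simp: \<C>_def)
  then have alt: "tv_le (planted_clique n k \<gamma> \<bind> (\<lambda>G. map_pmf (\<lambda>F. F G) D)) ?PDS
      (\<beta> + ?\<delta> + (\<beta> + ((\<epsilon> + 2 * \<beta>) / t + t) / 2))"
    unfolding planted_clique_clique_graph \<C>_def[symmetric] bind_assoc_pmf by simp
  obtain F where F: "F \<in> set_pmf D"
    "error_sum (erdos_renyi n \<gamma>) (planted_clique n k \<gamma>) (\<lambda>G. \<phi> (F G))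
      \<le> error_sum (erdos_renyi n \<gamma> \<bind> (\<lambda>G. map_pmf (\<lambda>F. F G) D))
          (planted_clique n k \<gamma> \<bind> (\<lambda>G. map_pmf (\<lambda>F. F G) D)) \<phi>"
    using error_sum_average[OF finD] .
  have "local_rewriting n N F"
    using F(1) by (auto simp: D_def local_rewriting_rewrite_graph)
  moreover note order_trans[OF F(2)[unfolded null] error_sum_tv_le[OF alt]]
  ultimately show thesis by (rule that)
qed


section \<open>Choice of the parameters\<close>

definition ceil_powr :: "nat \<Rightarrow> real \<Rightarrow> nat" where
  "ceil_powr n c = nat \<lceil>real n powr c\<rceil>"

lemma ceil_powr_bounds:
  assumes "0 < n" "0 \<le> c"
  shows "real n powr c \<le> ceil_powr n c" "ceil_powr n c \<le> 2 * real n powr c" "0 < ceil_powr n c"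
proof -
  have 1: "1 \<le> real n powr c" using assms by (simp add: ge_one_powr_ge_zero)
  show *: "real n powr c \<le> ceil_powr n c" unfolding ceil_powr_def by (rule real_nat_ceiling_ge)
  with 1 show "0 < ceil_powr n c" by linarith
  have "ceil_powr n c \<le> real n powr c + 1" unfolding ceil_powr_def using 1 by linarith
  then show "ceil_powr n c \<le> 2 * real n powr c" using 1 by simp
qed

lemma ceil_powr_le:
  assumes "0 < n" "c \<le> 1" shows "ceil_powr n c \<le> n"
proof -
  have "real n powr c \<le> real n powr 1" using assms by (intro powr_mono) auto
  then show ?thesis using assms by (simp add: ceil_powr_def ceiling_le_iff)
qed

lemma ln_ceil_powr_tendsto:
  assumes "0 \<le> c"
  shows "(\<lambda>n. ln (real (ceil_powr n c)) / ln (real n)) \<longlonglongrightarrow> c"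
proof (rule tendsto_sandwich)
  show "\<forall>\<^sub>F n in sequentially. c \<le> ln (real (ceil_powr n c)) / ln (real n)"
    using eventually_gt_at_top[of 1]
  proof eventually_elim
    case (elim n)
    then have "ln (real n powr c) \<le> ln (real (ceil_powr n c))"
      using ceil_powr_bounds[of n c] assms by (intro ln_mono) auto
    then show ?case using elim by (simp add: ln_powr field_simps)
  qed
  show "\<forall>\<^sub>F n in sequentially. ln (real (ceil_powr n c)) / ln (real n) \<le> ln 2 / ln (real n) + c"
    using eventually_gt_at_top[of 1]
  proof eventually_elim
    case (elim n)
    then have "ln (real (ceil_powr n c)) \<le> ln (2 * real n powr c)"
      using ceil_powr_bounds[of n c] assms by (intro ln_mono) auto
    also have "\<dots> = ln 2 + c * ln (real n)" using elim by (simp add: ln_mult ln_powr)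
    finally show ?case using elim by (simp add: field_simps)
  qed
  show "(\<lambda>n. ln 2 / ln (real n) + c) \<longlonglongrightarrow> c" by real_asymp
qed simp

text \<open>With \<open>\<mu> = a / (1 + a)\<close> and
  \<open>c = (\<beta> - \<mu>) / (1 - \<mu>)\<close> the conditions are linear in
  \<open>\<mu>\<close>: \<open>c < 1 / 2\<close> means \<open>\<mu> > 2 * \<beta> - 1\<close>,
  positivity of \<open>s\<close> means \<open>\<mu> < \<alpha> / 2\<close>, and the last condition
  means \<open>\<mu> < u\<close>. It remains to see that this interval meets the positive
  numbers.\<close>

lemma exponents_exist:
  fixes \<alpha> \<beta> :: real and m :: nat
  assumes \<alpha>: "0 < \<alpha>" "\<alpha> < \<beta>" and \<beta>: "\<beta> < 1" and m: "0 < m"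
    and bound: "\<beta> < 1 / 2 + (m * \<alpha> + 4) / (4 * m * \<alpha> + 4) * \<alpha> - 2 / (m * \<alpha>)"
  obtains a c where "0 < a" "a \<le> 1" "0 < c" "c < 1 / 2" "\<beta> * (1 + a) = c + a"
    "2 * a < \<alpha> * (1 + a)" "2 * c < Suc m * (\<alpha> * (1 + a) - 2 * a)"
proof -
  define t where "t = m * \<alpha>"
  have t0: "0 < t" using \<alpha> m by (simp add: t_def)
  \<comment> \<open>The excess of the fraction term over its limit \<open>\<alpha> / 4\<close> for
    large \<open>m\<close>.\<close>
  define x where "x = 3 * \<alpha> / (4 * t + 4)"
  have frac: "(m * \<alpha> + 4) / (4 * m * \<alpha> + 4) * \<alpha> = \<alpha> / 4 + x"
    using t0 by (simp add: x_def t_def[symmetric] mult.assoc divide_simps) (simp add: algebra_simps)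
  have b: "\<beta> < 1 / 2 + \<alpha> / 4 + x - 2 / t" using bound unfolding frac t_def by simp
  have x0: "0 < x" "x < 3 * \<alpha> / 4"
    using \<alpha> t0 by (auto simp: x_def field_simps)
  have "2 / t < 1 / 2" using b \<alpha> x0 by linarith
  then have t4: "4 < t" using t0 by (simp add: field_simps)
  have xt: "x < 2 / t"
  proof -
    define w where "w = \<alpha> * t"
    have "w < t" unfolding w_def using \<alpha> \<beta> t0 by simp
    then have "3 * w < 8 * t + 8" using t0 by linarith
    then show ?thesis using t0 by (simp add: x_def w_def divide_less_eq less_divide_eq mult_ac)
  qed
  have mx: "m * x \<le> 3 / 4"
  proof -
    have "m * x = 3 * t / (4 * t + 4)" by (simp add: x_def t_def)
    also have "\<dots> \<le> 3 / 4" using t0 by (simp add: field_simps)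
    finally show ?thesis .
  qed
  have mt: "m * (2 / t) > 2"
  proof -
    have "m * (2 / t) = 2 / \<alpha>" using m \<alpha> by (simp add: t_def)
    also have "\<dots> > 2" using \<alpha> \<beta> by (simp add: field_simps)
    finally show ?thesis .
  qed
  define u where "u = ((Suc m) * \<alpha> - 2 * \<beta>) / (2 * m)"
  have u0: "0 < u" using t4 \<alpha> \<beta> m by (simp add: u_def t_def algebra_simps)
  have ub: "2 * \<beta> - 1 < u"
  proof -
    \<comment> \<open>Cleared of denominators, \<open>2 * \<beta> - 1 < u\<close> reads
      \<open>(4 * m + 2) * \<beta> < 2 * m + Suc m * \<alpha>\<close>; hence the multiplier.\<close>
    have "(4 * m + 2) * \<beta> < (4 * m + 2) * (1 / 2 + \<alpha> / 4 + x - 2 / t)"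
      using b by (intro mult_strict_left_mono) auto
    also have "\<dots> = 2 * m + 1 + t + \<alpha> / 2 + 4 * (m * x) + 2 * x - 4 * (m * (2 / t)) - 2 * (2 / t)"
      by (simp add: t_def algebra_simps)
    also have "\<dots> < 2 * m + t + \<alpha>" using mx mt x0 xt \<alpha> \<beta> by linarith
    finally have "2 * \<beta> + 2 * m * (2 * \<beta> - 1) < Suc m * \<alpha>"
      by (simp add: t_def algebra_simps)
    then show ?thesis using m by (simp add: u_def field_simps)
  qed
  have "2 * \<beta> - 1 < \<alpha> / 2" using b xt by linarith
  then have "max 0 (2 * \<beta> - 1) < min (\<alpha> / 2) u"
    unfolding max_less_iff_conj min_less_iff_conj using \<alpha> u0 ub by simp
  then obtain \<mu> where \<mu>: "max 0 (2 * \<beta> - 1) < \<mu>" "\<mu> < min (\<alpha> / 2) u" using dense by blast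
  have \<mu>1: "\<mu> < 1 / 2" "\<mu> < \<beta>" using \<mu> \<alpha> \<beta> by auto
  have u: "2 * (\<beta> - \<mu>) < Suc m * (\<alpha> - 2 * \<mu>)"
    using \<mu>(2) m by (simp add: u_def field_simps)
  have inv: "1 + \<mu> / (1 - \<mu>) = 1 / (1 - \<mu>)" using \<mu>1 by (simp add: field_simps)
  show thesis
  proof (rule that[of "\<mu> / (1 - \<mu>)" "(\<beta> - \<mu>) / (1 - \<mu>)"])
    show "2 * ((\<beta> - \<mu>) / (1 - \<mu>)) < Suc m * (\<alpha> * (1 + \<mu> / (1 - \<mu>)) - 2 * (\<mu> / (1 - \<mu>)))"
      unfolding inv using divide_strict_right_mono[OF u, of "1 - \<mu>"] \<mu>1
      by (simp add: diff_divide_distrib algebra_simps)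
    show "\<beta> * (1 + \<mu> / (1 - \<mu>)) = (\<beta> - \<mu>) / (1 - \<mu>) + \<mu> / (1 - \<mu>)"
      unfolding inv by (simp flip: add_divide_distrib)
    have "2 * \<mu> / (1 - \<mu>) < \<alpha> / (1 - \<mu>)"
      using \<mu>(2) \<mu>1 by (intro divide_strict_right_mono) auto
    then show "2 * (\<mu> / (1 - \<mu>)) < \<alpha> * (1 + \<mu> / (1 - \<mu>))"
      unfolding inv by simp
  qed (use \<mu> \<mu>1 \<alpha> \<beta> in \<open>auto simp: field_simps\<close>)
qed

lemma exponents_exist_large:
  fixes \<alpha> \<beta> :: real
  assumes "0 < \<alpha>" "\<beta> < 1 / 2 + \<alpha> / 4"
  obtains m :: nat where "0 < m"
    "\<beta> < 1 / 2 + (m * \<alpha> + 4) / (4 * m * \<alpha> + 4) * \<alpha> - 2 / (m * \<alpha>)"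
proof -
  have "(\<lambda>m::nat. 1 / 2 + (m * \<alpha> + 4) / (4 * m * \<alpha> + 4) * \<alpha> - 2 / (m * \<alpha>)) \<longlonglongrightarrow> 1 / 2 + \<alpha> / 4"
    using assms(1) by real_asymp
  then have "\<forall>\<^sub>F m::nat in sequentially. \<beta> < 1 / 2 + (m * \<alpha> + 4) / (4 * m * \<alpha> + 4) * \<alpha> - 2 / (m * \<alpha>)"
    using assms(2) by (rule order_tendstoD)
  with eventually_gt_at_top[of 0] have
    "\<forall>\<^sub>F m::nat in sequentially. 0 < m \<and> \<beta> < 1 / 2 + (m * \<alpha> + 4) / (4 * m * \<alpha> + 4) * \<alpha> - 2 / (m * \<alpha>)"
    by eventually_elim simp
  then show thesis using that by (auto dest: eventually_happens)
qed

text \<open>Bounds \<open>2 * q * L\<^sup>2\<close>: the load limit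
  \<open>L = 3 * ceil_powr n a\<close> is at most \<open>6 * n powr a\<close>, whence 36, and
  \<open>2 * q\<close> is at most \<open>n powr (- (\<alpha> * (1 + a)))\<close>.\<close>

definition density_bound :: "real \<Rightarrow> nat \<Rightarrow> real" where
  "density_bound s n = 36 * real n powr (- s)"

definition load_bound :: "real \<Rightarrow> nat \<Rightarrow> real" where
  "load_bound a n = real n * 2 powr (- (real n powr a))"

text \<open>Bounds \<open>\<epsilon> + 2 * \<beta>\<close> of the reduction. Its square root serves
  as the free parameter \<open>t\<close>, since then
  \<open>((\<epsilon> + 2 * \<beta>) / t + t) / 2 \<le> t\<close>.\<close>

definition moment_bound :: "real \<Rightarrow> real \<Rightarrow> nat \<Rightarrow> real" where
  "moment_bound s a n =
     exp (density_bound s n * exp (density_bound s n)) - 1 + 2 * load_bound a n"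

definition error_bound :: "real \<Rightarrow> real \<Rightarrow> real \<Rightarrow> nat \<Rightarrow> nat \<Rightarrow> real" where
  "error_bound s a c m n = 2 * load_bound a n
     + 4 * real n powr (2 * c) * density_bound s n ^ Suc m + sqrt (moment_bound s a n)"

text \<open>The middle term has order \<open>n powr (2 * c - Suc m * s)\<close>; \<open>s\<close>
  and \<open>a\<close> being positive handles the density and the load.\<close>

lemma error_bound_tendsto:
  fixes s a c :: real
  assumes s: "0 < s" and a: "0 < a" and c: "2 * c < Suc m * s"
  shows "error_bound s a c m \<longlonglongrightarrow> 0" "density_bound s \<longlonglongrightarrow> 0"
proof -
  show d: "density_bound s \<longlonglongrightarrow> 0" unfolding density_bound_def using s by real_asymp
  have l: "load_bound a \<longlonglongrightarrow> 0" unfolding load_bound_def using a by real_asymp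
  have "moment_bound s a \<longlonglongrightarrow> exp (0 * exp 0) - 1 + 2 * 0"
    unfolding moment_bound_def by (intro tendsto_intros d l)
  then have e: "(\<lambda>n. sqrt (moment_bound s a n)) \<longlonglongrightarrow> sqrt 0" by (intro tendsto_real_sqrt) simp
  have "(\<lambda>n. 4 * real n powr (2 * c) * density_bound s n ^ Suc m) \<longlonglongrightarrow> 0"
  proof (rule Lim_transform_eventually)
    have "2 * c - Suc m * s < 0" using c by linarith
    then show "(\<lambda>n::nat. 4 * 36 ^ Suc m * real n powr (2 * c - Suc m * s)) \<longlonglongrightarrow> 0" by real_asymp
    show "\<forall>\<^sub>F n in sequentially. 4 * 36 ^ Suc m * real n powr (2 * c - Suc m * s)
      = 4 * real n powr (2 * c) * density_bound s n ^ Suc m"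
      using eventually_gt_at_top[of 0]
    proof eventually_elim
      case (elim n)
      have "(real n powr (- s)) ^ Suc m = real n powr (- (Suc m * s))"
        using elim by (subst powr_realpow[symmetric]) (simp_all add: powr_powr mult.commute del: power_Suc)
      then show ?case using elim
        by (simp add: density_bound_def power_mult_distrib powr_diff powr_minus divide_inverse del: power_Suc)
    qed
  qed
  from tendsto_add[OF tendsto_add[OF tendsto_mult[OF tendsto_const[of 2] l] this] e]
  show "error_bound s a c m \<longlonglongrightarrow> 0" unfolding error_bound_def by simp
qed


section \<open>Hardness of the planted dense subgraph problem\<close>

lemma liminf_ge_1_transfer:
  fixes a b d :: "nat \<Rightarrow> real"
  assumes a: "liminf (\<lambda>n. ereal (a n)) \<ge> 1" and d: "d \<longlonglongrightarrow> 0"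
    and le: "\<forall>\<^sub>F n in sequentially. a (Suc n) \<le> b n + d n"
  shows "liminf (\<lambda>n. ereal (b n)) \<ge> 1"
  unfolding le_Liminf_iff
proof (intro allI impI)
  fix y :: ereal assume "y < 1"
  then obtain r where r: "y < ereal r" "ereal r < 1" using ereal_dense2 by blast
  define e where "e = (1 - r) / 2"
  have e: "0 < e" "r + e < 1" using r(2) by (auto simp: e_def field_simps)
  have "\<forall>\<^sub>F n in sequentially. ereal (r + e) < ereal (a n)"
    using a e(2) unfolding le_Liminf_iff by (metis ereal_less(3))
  then have "\<forall>\<^sub>F n in sequentially. ereal (r + e) < ereal (a (Suc n))"
    by (rule eventually_compose_filterlim[OF _ filterlim_Suc])
  moreover have "\<forall>\<^sub>F n in sequentially. d n < e" using d e(1) by (rule order_tendstoD)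
  ultimately show "\<forall>\<^sub>F n in sequentially. y < ereal (b n)"
    using le
  proof eventually_elim
    case (elim n)
    then have "ereal r < ereal (b n)" by simp
    with r(1) show ?case by (rule less_trans)
  qed
qed

lemma local_rewriting_trivial: "local_rewriting n N (\<lambda>G e. False)"
proof -
  have "\<exists>src u v. \<forall>(G :: graph) e. e \<in> vertex_pairs N \<longrightarrow> False = (if G (src e) then u e else v e)"
    by (rule exI[of _ "\<lambda>e. e"], rule exI[of _ "\<lambda>_. False"], rule exI[of _ "\<lambda>_. False"]) simp
  then show ?thesis by (simp add: local_rewriting_def graphs_def)
qed

text \<open>Since \<open>N n \<le> n\<^sup>2\<close>, a polynomial in the new number of vertices is
  one in the old. \<open>Suc\<close> skips the empty graph, where the trivial test stands
  in.\<close>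

lemma polynomial_time_rewriting:
  assumes \<phi>: "polynomial_time_tests (\<lambda>l. N (Suc l)) \<phi>"
    and F: "\<And>n. local_rewriting n (N n) (F n)"
    and N: "\<And>n. 0 < n \<Longrightarrow> n \<le> N n \<and> N n \<le> n\<^sup>2"
  shows "polynomial_time_tests (\<lambda>n. n)
    (\<lambda>n. if n = 0 then (\<lambda>G. return_pmf (n \<noteq> 0)) else (\<lambda>G. \<phi> (n - 1) (F n G)))"
proof -
  obtain c where c: "\<And>l. \<exists>P. length P \<le> N (Suc l) ^ c + c \<and>
      computes_within P (N (Suc l)) (N (Suc l) ^ c + c) (\<phi> l)"
    using \<phi> by (auto simp: polynomial_time_tests_def)
  \<comment> \<open>The exponent doubles because of \<open>N n \<le> n\<^sup>2\<close>. For
    \<open>n = 1\<close> powers do not grow, and the additive 24 must pay for the rewriting; for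
    larger \<open>n\<close> it covers the extra factor \<open>n ^ 8\<close>.\<close>
  define c' where "c' = 2 * c + 24"
  show ?thesis
    unfolding polynomial_time_tests_def
  proof (intro exI[of _ c'] allI)
    fix n :: nat
    show "\<exists>P. length P \<le> n ^ c' + c' \<and> computes_within P n (n ^ c' + c')
      (if n = 0 then (\<lambda>G. return_pmf (n \<noteq> 0)) else (\<lambda>G. \<phi> (n - 1) (F n G)))"
    proof (cases "n = 0")
      case True
      then show ?thesis using computes_trivial[of n] by (intro exI[of _ "[]"]) simp
    next
      case False
      then have n: "0 < n" by simp
      obtain P where P: "length P \<le> N n ^ c + c" "computes_within P (N n) (N n ^ c + c) (\<phi> (n - 1))"
        using c[of "n - 1"] n by auto
      have budget: "N n ^ c + c + 12 * (N n)\<^sup>2 + 12 \<le> n ^ c' + c'"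
      proof -
        have "N n ^ c \<le> n ^ (2 * c)"
          using power_mono[of "N n" "n\<^sup>2" c] N[OF n] by (simp add: power_mult)
        moreover have "(N n)\<^sup>2 \<le> n ^ 4"
          using power_mono[of "N n" "n\<^sup>2" 2] N[OF n] by (simp flip: power_mult)
        ultimately have "N n ^ c + c + 12 * (N n)\<^sup>2 + 12 \<le> n ^ (2 * c) + 12 * n ^ 4 + (c + 12)"
          by linarith
        also have "\<dots> \<le> n ^ c' + c'"
        proof (cases "n = 1")
          case False
          with n have n2: "2 \<le> n" by simp
          have "n ^ (2 * c) + 12 * n ^ 4 \<le> n ^ (2 * c) * n ^ 4 + 12 * (n ^ (2 * c) * n ^ 4)"
            using n by (intro add_mono mult_left_mono) auto
          also have "\<dots> \<le> 2 ^ 4 * (n ^ (2 * c) * n ^ 4)" by simp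
          also have "\<dots> \<le> n ^ 4 * (n ^ (2 * c) * n ^ 4)"
            using n2 by (intro mult_right_mono power_mono) auto
          also have "\<dots> = n ^ (2 * c + 8)" by (simp only: power_add[symmetric]) (simp add: add_ac)
          also have "\<dots> \<le> n ^ c'" using n by (intro power_increasing) (auto simp: c'_def)
          finally show ?thesis by (simp add: c'_def)
        qed (simp add: c'_def)
        finally show ?thesis .
      qed
      obtain P' where P': "length P' \<le> length P + 12 * (N n)\<^sup>2 + 12"
        "computes_within P' n (n ^ c' + c') (\<lambda>G. \<phi> (n - 1) (F n G))"
      proof (rule computes_rewriting[OF F[of n] _ P(2)])
        show "n \<le> N n" using N[OF n] by simp
      qed (use budget in auto)
      have "length P' \<le> n ^ c' + c'" using P'(1) P(1) budget by linarith
      with P'(2) n show ?thesis by auto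
    qed
  qed
qed

text \<open>The mean load is \<open>len\<close> and the limit is \<open>3 * len\<close>. The
  exponential moment is at most \<open>exp 1 ^ len\<close>, hence at most \<open>4 ^ len\<close>,
  against the threshold \<open>8 ^ len\<close>.\<close>

lemma load_term_le:
  assumes n: "0 < n" and len: "real n powr a \<le> len"
  shows "real n * ((1 + 1 / n) ^ (n * len) / 2 ^ (3 * len)) \<le> load_bound a n"
proof -
  have "(1 + 1 / real n) ^ (n * len) \<le> exp (1 / n) ^ (n * len)"
    by (intro power_mono) (auto intro: order_trans[OF _ exp_ge_add_one_self])
  also have "\<dots> = exp 1 ^ len" using n by (simp add: exp_of_nat_mult[symmetric] power_mult)
  also have "\<dots> \<le> 4 ^ len" using exp_le by (intro power_mono) auto
  finally have "(1 + 1 / real n) ^ (n * len) / 2 ^ (3 * len) \<le> 4 ^ len / 2 ^ (3 * len)"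
    by (intro divide_right_mono) auto
  also have "\<dots> = (4 / 8) ^ len" by (simp only: power_mult power_divide[symmetric]) simp
  also have "\<dots> = 2 powr (- real len)" by (simp add: powr_minus_divide powr_realpow power_one_over)
  also have "\<dots> \<le> 2 powr (- (real n powr a))" using len by (intro powr_mono) auto
  finally show ?thesis using n unfolding load_bound_def by (intro mult_left_mono) auto
qed

lemma reduction_bound:
  fixes \<gamma> \<alpha> a c :: real and m n :: nat and \<phi> :: test
  assumes \<gamma>: "0 < \<gamma>" "\<gamma> < 1" "\<gamma> * 2 ^ m \<le> 1" and \<alpha>: "0 < \<alpha>"
    and a: "0 < a" and c: "0 < c" and n: "0 < n" "2 * real n powr c < n"
  defines "s \<equiv> \<alpha> * (1 + a) - 2 * a"
  assumes small: "density_bound s n \<le> 1 / 2"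
  defines "len \<equiv> ceil_powr n a" and "k \<equiv> ceil_powr n c"
  defines "q \<equiv> real (n * len) powr (- \<alpha>) / 2"
  obtains F where "local_rewriting n (n * len) F"
    "error_sum (erdos_renyi n \<gamma>) (planted_clique n k \<gamma>) (\<lambda>G. \<phi> (F G))
      \<le> error_sum (erdos_renyi (n * len) q) (planted_dense_subgraph (n * len) (k * len) (2 * q) q) \<phi>
        + error_bound s a c m n"
proof -
  note len = ceil_powr_bounds[of n a, folded len_def]
  note kb = ceil_powr_bounds[of n c, folded k_def]
  define L where "L = 3 * len"
  define y where "y = density_bound s n"
  define z where "z = load_bound a n"
  define t where "t = sqrt (moment_bound s a n)"
  have len0: "0 < len" using len(3) n a by simp
  have q0: "0 < q" using len0 n by (simp add: q_def)
  have y0: "0 < y" using n by (simp add: y_def density_bound_def)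
  have qL: "2 * q * L\<^sup>2 \<le> y"
  proof -
    have "real n powr (1 + a) \<le> real (n * len)"
      using len(1) n a by (simp add: powr_add)
    then have "real (n * len) powr (- \<alpha>) \<le> (real n powr (1 + a)) powr (- \<alpha>)"
      using n \<alpha> by (intro powr_mono2') auto
    then have "2 * q \<le> real n powr (- (\<alpha> * (1 + a)))"
      by (simp add: q_def powr_powr mult.commute)
    moreover have "(real L)\<^sup>2 \<le> (6 * real n powr a)\<^sup>2"
      using len(2) n a by (intro power_mono) (auto simp: L_def)
    ultimately have "2 * q * (real L)\<^sup>2 \<le> real n powr (- (\<alpha> * (1 + a))) * (6 * real n powr a)\<^sup>2"
      using q0 by (intro mult_mono) auto
    also have "\<dots> = y"
      using n by (simp add: y_def density_bound_def s_def power_mult_distrib power2_eq_square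
          powr_add[symmetric] powr_diff powr_minus field_simps)
    finally show ?thesis by simp
  qed
  have L1: "1 \<le> real L" using len0 by (simp add: L_def)
  then have "1 \<le> (real L)\<^sup>2" by simp
  then have "2 * q * 1 \<le> 2 * q * L\<^sup>2" using q0 by (intro mult_left_mono) auto
  \<comment> \<open>The density bound also keeps \<open>q\<close> away from \<open>1 / 2\<close>, so
    that \<open>\<rho>\<close> is comparable to \<open>q\<close>.\<close>
  then have q4: "q \<le> 1 / 4" using qL small by (simp add: y_def)
  define \<rho> where "\<rho> = q / (2 * (1 - 2 * q))"
  define \<epsilon> where "\<epsilon> = exp (L\<^sup>2 * (\<rho> * (1 + \<rho>) ^ L)) - 1"
  define \<beta> where "\<beta> = n * ((1 + 1 / n) ^ (n * len) / 2 ^ L)"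
  have \<rho>: "0 \<le> \<rho>" "\<rho> \<le> q" using q0 q4 by (auto simp: \<rho>_def divide_simps)
  have \<rho>L: "(real L)\<^sup>2 * \<rho> \<le> y"
  proof -
    have "(real L)\<^sup>2 * \<rho> \<le> (real L)\<^sup>2 * (2 * q)" using \<rho> q0 by (intro mult_left_mono) auto
    then show ?thesis using qL by (simp add: mult_ac)
  qed
  have "(1 + \<rho>) ^ L \<le> exp \<rho> ^ L" using \<rho> by (intro power_mono exp_ge_add_one_self) auto
  also have "\<dots> = exp (L * \<rho>)" by (simp add: exp_of_nat_mult)
  also have "\<dots> \<le> exp y"
  proof -
    have "real L * \<rho> \<le> (real L)\<^sup>2 * \<rho>"
      using L1 \<rho> by (intro mult_right_mono) (auto simp: power2_eq_square)
    then show ?thesis using \<rho>L by simp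
  qed
  finally have "(1 + \<rho>) ^ L \<le> exp y" .
  then have "(real L)\<^sup>2 * \<rho> * (1 + \<rho>) ^ L \<le> y * exp y"
    using \<rho>L \<rho> y0 by (intro mult_mono) auto
  then have \<epsilon>: "\<epsilon> \<le> exp (y * exp y) - 1" by (simp add: \<epsilon>_def mult.assoc)
  have \<beta>: "\<beta> \<le> z" unfolding \<beta>_def z_def L_def using n len(1) a by (intro load_term_le) auto
  have z0: "0 \<le> z" by (simp add: z_def load_bound_def)
  have mb: "\<epsilon> + 2 * \<beta> \<le> moment_bound s a n"
    using \<epsilon> \<beta> by (simp add: moment_bound_def y_def z_def)
  have mb0: "0 < moment_bound s a n"
    using y0 z0 by (auto simp: moment_bound_def y_def z_def intro!: add_pos_nonneg)
  then have t0: "0 < t" by (simp add: t_def)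
  have t2: "moment_bound s a n = t * t" using mb0 by (simp add: t_def)
  have "real k < real n" using kb(2)[OF n(1) less_imp_le[OF c]] n(2) by linarith
  then have k0: "0 < k" "k < n" using kb(3) c n by auto
  obtain F where F: "local_rewriting n (n * len) F"
    "error_sum (erdos_renyi n \<gamma>) (planted_clique n k \<gamma>) (\<lambda>G. \<phi> (F G))
      \<le> error_sum (erdos_renyi (n * len) q) (planted_dense_subgraph (n * len) (k * len) (2 * q) q) \<phi>
        + (\<beta> + k\<^sup>2 * (2 * q * L\<^sup>2) ^ Suc m + (\<beta> + ((\<epsilon> + 2 * \<beta>) / t + t) / 2))"
    unfolding \<epsilon>_def \<beta>_def \<rho>_def
  proof (rule planted_clique_reduction[OF \<gamma> q0 _ t0 k0])
    show "q < 1 / 2" using q4 by simp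
    show "real (k * len) / real (n * len) = real k / real n" using len0 by simp
  qed
  have "(real k)\<^sup>2 * (2 * q * L\<^sup>2) ^ Suc m \<le> 4 * real n powr (2 * c) * y ^ Suc m"
  proof (intro mult_mono power_mono qL)
    have "(real k)\<^sup>2 \<le> (2 * real n powr c)\<^sup>2" using kb(2) n c by (intro power_mono) auto
    also have "\<dots> = 4 * real n powr (2 * c)"
      by (simp add: power_mult_distrib power2_eq_square powr_add[symmetric])
    finally show "(real k)\<^sup>2 \<le> 4 * real n powr (2 * c)" .
  qed (use q0 in auto)
  then have edges: "k\<^sup>2 * (2 * q * L\<^sup>2) ^ Suc m \<le> 4 * real n powr (2 * c) * y ^ Suc m"
    by (simp only: of_nat_power)
  have "(\<epsilon> + 2 * \<beta>) / t \<le> t"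
    using mb t0 by (simp add: t2 divide_le_eq)
  then have diagonal: "((\<epsilon> + 2 * \<beta>) / t + t) / 2 \<le> t" by simp
  have "\<beta> + k\<^sup>2 * (2 * q * L\<^sup>2) ^ Suc m + (\<beta> + ((\<epsilon> + 2 * \<beta>) / t + t) / 2)
    \<le> z + 4 * real n powr (2 * c) * y ^ Suc m + (z + t)"
    by (intro add_mono \<beta> edges diagonal)
  also have "\<dots> = error_bound s a c m n"
    unfolding error_bound_def y_def[symmetric] z_def[symmetric] t_def[symmetric] by simp
  finally have total: "\<beta> + k\<^sup>2 * (2 * q * L\<^sup>2) ^ Suc m + (\<beta> + ((\<epsilon> + 2 * \<beta>) / t + t) / 2)
    \<le> error_bound s a c m n" .
  show thesis by (rule that[OF F(1) order_trans[OF F(2) add_left_mono[OF total]]])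
qed

text \<open>On the scale of \<open>ln n\<close>, \<open>N\<close> has exponent \<open>1 + a\<close>
  and \<open>K\<close> has exponent \<open>c + a\<close>. The factor \<open>1 / 2\<close> in the
  density ensures \<open>2 * q \<le> 1\<close> and disappears in the limit.\<close>

lemma pds_sequence_powr:
  fixes \<alpha> \<beta> a c :: real
  assumes \<alpha>: "0 < \<alpha>" and a: "0 < a" and c: "0 < c" "c < 1" and \<beta>: "\<beta> * (1 + a) = c + a"
  shows "pds_sequence \<alpha> \<beta> (\<lambda>l. Suc l * ceil_powr (Suc l) a)
    (\<lambda>l. ceil_powr (Suc l) c * ceil_powr (Suc l) a)
    (\<lambda>l. real (Suc l * ceil_powr (Suc l) a) powr (- \<alpha>) / 2)"
proof -
  let ?len = "\<lambda>n. ceil_powr n a" and ?k = "\<lambda>n. ceil_powr n c"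
  let ?N = "\<lambda>n. n * ?len n"
  have len: "0 < ?len n" and k: "0 < ?k n" "?k n \<le> n" if "0 < n" for n
    using ceil_powr_bounds(3)[of n] ceil_powr_le[of n c] that a c by auto
  have N_ge: "n \<le> ?N n" if "0 < n" for n using len[OF that] by simp
  have N_top: "filterlim ?N at_top sequentially"
    by (rule filterlim_at_top_mono[OF filterlim_ident])
      (use eventually_gt_at_top[of 0] in eventually_elim, rule N_ge)
  have lnN: "(\<lambda>n. ln (real (?N n)) / ln (real n)) \<longlonglongrightarrow> 1 + a"
  proof (rule Lim_transform_eventually)
    show "(\<lambda>n. 1 + ln (real (?len n)) / ln (real n)) \<longlonglongrightarrow> 1 + a"
      using a by (intro tendsto_intros ln_ceil_powr_tendsto) auto
    show "\<forall>\<^sub>F n in sequentially. 1 + ln (real (?len n)) / ln (real n) = ln (real (?N n)) / ln (real n)"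
      using eventually_gt_at_top[of 1]
      by eventually_elim (use len in \<open>simp add: ln_mult add_divide_distrib\<close>)
  qed
  have lnK: "(\<lambda>n. ln (real (?k n * ?len n)) / ln (real n)) \<longlonglongrightarrow> c + a"
  proof (rule Lim_transform_eventually)
    show "(\<lambda>n. ln (real (?k n)) / ln (real n) + ln (real (?len n)) / ln (real n)) \<longlonglongrightarrow> c + a"
      using a c by (intro tendsto_intros ln_ceil_powr_tendsto) auto
    show "\<forall>\<^sub>F n in sequentially. ln (real (?k n)) / ln (real n) + ln (real (?len n)) / ln (real n)
        = ln (real (?k n * ?len n)) / ln (real n)"
      using eventually_gt_at_top[of 1]
      by eventually_elim (use len k in \<open>simp add: ln_mult add_divide_distrib\<close>)
  qed
  have K: "(\<lambda>n. ln (real (?k n * ?len n)) / ln (real (?N n))) \<longlonglongrightarrow> \<beta>"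
  proof (rule Lim_transform_eventually)
    have "(c + a) / (1 + a) = \<beta>" using \<beta> a by (simp add: field_simps)
    then show "(\<lambda>n. (ln (real (?k n * ?len n)) / ln (real n)) / (ln (real (?N n)) / ln (real n))) \<longlonglongrightarrow> \<beta>"
      using tendsto_divide[OF lnK lnN] a by simp
    show "\<forall>\<^sub>F n in sequentially. (ln (real (?k n * ?len n)) / ln (real n)) / (ln (real (?N n)) / ln (real n))
        = ln (real (?k n * ?len n)) / ln (real (?N n))"
      using eventually_gt_at_top[of 1] by eventually_elim simp
  qed
  have q: "(\<lambda>n. ln (1 / (real (?N n) powr (- \<alpha>) / 2)) / ln (real (?N n))) \<longlonglongrightarrow> \<alpha>"
  proof (rule Lim_transform_eventually)
    have "filterlim (\<lambda>n. ln (real (?N n))) at_top sequentially"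
      by (rule filterlim_compose[OF ln_at_top filterlim_compose[OF filterlim_real_sequentially N_top]])
    then have "(\<lambda>n. ln 2 / ln (real (?N n)) + \<alpha>) \<longlonglongrightarrow> 0 + \<alpha>"
      by (intro tendsto_intros tendsto_divide_0[OF tendsto_const] filterlim_at_top_imp_at_infinity)
    then show "(\<lambda>n. ln 2 / ln (real (?N n)) + \<alpha>) \<longlonglongrightarrow> \<alpha>" by simp
    show "\<forall>\<^sub>F n in sequentially. ln 2 / ln (real (?N n)) + \<alpha>
        = ln (1 / (real (?N n) powr (- \<alpha>) / 2)) / ln (real (?N n))"
      using eventually_gt_at_top[of 1]
    proof eventually_elim
      case (elim n)
      then have N1: "1 < real (?N n)" using N_ge[of n] by linarith
      have "ln (1 / (x powr (- \<alpha>) / 2)) = ln 2 + \<alpha> * ln x" if "1 < x" for x :: real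
      proof -
        have "1 / (x powr (- \<alpha>) / 2) = 2 * x powr \<alpha>" using that by (simp add: powr_minus field_simps)
        then show ?thesis using that by (simp add: ln_mult ln_powr)
      qed
      from this[OF N1] have "ln (1 / (real (?N n) powr (- \<alpha>) / 2)) = ln 2 + \<alpha> * ln (real (?N n))" .
      moreover have "0 < ln (real (?N n))" using N1 by (rule ln_gt_zero)
      ultimately show ?case by (simp add: add_divide_distrib)
    qed
  qed
  have powr_le: "real x powr (- \<alpha>) \<le> 1" if "0 < x" for x :: nat
    using powr_mono[of "- \<alpha>" 0 "real x"] that \<alpha> by simp
  show ?thesis
    unfolding pds_sequence_def
  proof (intro conjI allI)
    fix l
    show "0 < ?k (Suc l) * ?len (Suc l)" "?k (Suc l) * ?len (Suc l) \<le> ?N (Suc l)"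
      using len[of "Suc l"] k[of "Suc l"] by (auto intro: mult_right_mono simp del: mult_Suc)
    show "0 < real (?N (Suc l)) powr (- \<alpha>) / 2"
      using len[of "Suc l"] by (simp del: mult_Suc of_nat_Suc)
    show "2 * (real (?N (Suc l)) powr (- \<alpha>) / 2) \<le> 1"
      using powr_le[of "?N (Suc l)"] len[of "Suc l"] by simp
    show "filterlim (\<lambda>l. ?N (Suc l)) sequentially sequentially"
      by (rule filterlim_compose[OF N_top filterlim_Suc])
    show "(\<lambda>l. ln (1 / (real (?N (Suc l)) powr (- \<alpha>) / 2)) / ln (real (?N (Suc l)))) \<longlonglongrightarrow> \<alpha>"
      by (rule LIMSEQ_Suc[OF q])
    show "(\<lambda>l. ln (real (?k (Suc l) * ?len (Suc l))) / ln (real (?N (Suc l)))) \<longlonglongrightarrow> \<beta>"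
      by (rule LIMSEQ_Suc[OF K])
  qed
qed

text \<open>Tests for the dense subgraph problem are pulled back along rewritings chosen separately
  for each \<open>n\<close>, and may depend on the tests. Indices that are not \<open>good\<close>
  get a constant rewriting, because the polynomial time bound concerns every index.\<close>

lemma pds_hardness:
  fixes \<gamma> \<alpha> \<beta> :: real and m :: nat
  assumes hyp: "planted_clique_hypothesis \<gamma>" and \<gamma>: "0 < \<gamma>" "\<gamma> < 1" "\<gamma> * 2 ^ m \<le> 1"
    and m: "0 < m" and \<alpha>: "0 < \<alpha>" "\<alpha> < \<beta>" and \<beta>: "\<beta> < 1"
    and bound: "\<beta> < 1 / 2 + (m * \<alpha> + 4) / (4 * m * \<alpha> + 4) * \<alpha> - 2 / (m * \<alpha>)"
  shows "\<exists>N K q. pds_sequence \<alpha> \<beta> N K q \<and>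
    (\<forall>\<phi>. polynomial_time_tests N \<phi> \<longrightarrow>
      liminf (\<lambda>l. ereal (error_sum (erdos_renyi (N l) (q l))
        (planted_dense_subgraph (N l) (K l) (2 * q l) (q l)) (\<phi> l))) \<ge> 1)"
proof -
  obtain a c where ac: "0 < a" "a \<le> 1" "0 < c" "c < 1 / 2" "\<beta> * (1 + a) = c + a"
    "2 * a < \<alpha> * (1 + a)" "2 * c < Suc m * (\<alpha> * (1 + a) - 2 * a)"
    using exponents_exist[OF \<alpha> \<beta> m bound] .
  define s where "s = \<alpha> * (1 + a) - 2 * a"
  have s: "0 < s" "2 * c < Suc m * s" using ac by (auto simp: s_def)
  define k where "k n = ceil_powr n c" for n
  define N where "N n = n * ceil_powr n a" for n
  define K where "K n = k n * ceil_powr n a" for n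
  define q where "q n = real (N n) powr (- \<alpha>) / 2" for n
  define good where "good n \<longleftrightarrow> 0 < n \<and> 2 * real n powr c < n \<and> density_bound s n \<le> 1 / 2" for n :: nat
  have ev_good: "\<forall>\<^sub>F n in sequentially. good n"
  proof -
    have "\<forall>\<^sub>F n::nat in sequentially. 2 * real n powr c < n" using ac by real_asymp
    moreover have "\<forall>\<^sub>F n in sequentially. density_bound s n < 1 / 2"
      using error_bound_tendsto(2)[OF s(1) ac(1) s(2)] by (rule order_tendstoD) simp
    ultimately show ?thesis using eventually_gt_at_top[of 0]
      by eventually_elim (simp add: good_def)
  qed
  have "liminf (\<lambda>l. ereal (error_sum (erdos_renyi (N (Suc l)) (q (Suc l)))
      (planted_dense_subgraph (N (Suc l)) (K (Suc l)) (2 * q (Suc l)) (q (Suc l))) (\<phi> l))) \<ge> 1"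
    if \<phi>: "polynomial_time_tests (\<lambda>l. N (Suc l)) \<phi>" for \<phi>
  proof -
    let ?err = "\<lambda>n. error_sum (erdos_renyi (N n) (q n)) (planted_dense_subgraph (N n) (K n) (2 * q n) (q n)) (\<phi> (n - 1))"
    let ?pc = "\<lambda>n \<psi>. error_sum (erdos_renyi n \<gamma>) (planted_clique n (k n) \<gamma>) \<psi>"
    have "\<forall>n. \<exists>F. local_rewriting n (N n) F \<and>
      (good n \<longrightarrow> ?pc n (\<lambda>G. \<phi> (n - 1) (F G)) \<le> ?err n + error_bound s a c m n)"
    proof
      fix n
      show "\<exists>F. local_rewriting n (N n) F \<and>
        (good n \<longrightarrow> ?pc n (\<lambda>G. \<phi> (n - 1) (F G)) \<le> ?err n + error_bound s a c m n)"
      proof (cases "good n")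
        case True
        then have good: "0 < n" "2 * real n powr c < n" "density_bound (\<alpha> * (1 + a) - 2 * a) n \<le> 1 / 2"
          by (simp_all add: good_def s_def)
        obtain F where "local_rewriting n (N n) F"
          "?pc n (\<lambda>G. \<phi> (n - 1) (F G)) \<le> ?err n + error_bound s a c m n"
          unfolding s_def N_def K_def k_def q_def
          by (rule reduction_bound[OF \<gamma> \<alpha>(1) ac(1,3) good])
        then show ?thesis by (intro exI[of _ F] conjI impI)
      next
        case False
        then show ?thesis
          by (intro exI[of _ "\<lambda>G e. False"] conjI local_rewriting_trivial) simp
      qed
    qed
    from choice[OF this] obtain F where "\<forall>n. local_rewriting n (N n) (F n) \<and>
      (good n \<longrightarrow> ?pc n (\<lambda>G. \<phi> (n - 1) (F n G)) \<le> ?err n + error_bound s a c m n)" ..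
    then have F: "\<And>n. local_rewriting n (N n) (F n)"
      "\<And>n. good n \<Longrightarrow> ?pc n (\<lambda>G. \<phi> (n - 1) (F n G)) \<le> ?err n + error_bound s a c m n"
      by simp_all
    define \<psi> where "\<psi> n = (if n = 0 then (\<lambda>G. return_pmf (n \<noteq> 0)) else (\<lambda>G. \<phi> (n - 1) (F n G)))" for n
    have poly: "polynomial_time_tests (\<lambda>n. n) \<psi>"
      unfolding \<psi>_def
    proof (rule polynomial_time_rewriting[OF \<phi> F(1)])
      fix n :: nat assume n: "0 < n"
      then show "n \<le> N n \<and> N n \<le> n\<^sup>2"
        using ceil_powr_bounds(3)[of n a] ceil_powr_le[of n a] ac
        by (auto simp: N_def power2_eq_square)
    qed
    have k: "\<forall>n>0. 0 < k n \<and> k n \<le> n"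
      using ceil_powr_bounds(3)[of _ c] ceil_powr_le[of _ c] ac by (auto simp: k_def)
    have limsup: "limsup (\<lambda>n. ereal (ln (real (k n)) / ln (real n))) < ereal (1 / 2)"
    proof -
      have "(\<lambda>n. ereal (ln (real (k n)) / ln (real n))) \<longlonglongrightarrow> ereal c"
        unfolding k_def using ac by (intro tendsto_ereal ln_ceil_powr_tendsto) simp
      then have "limsup (\<lambda>n. ereal (ln (real (k n)) / ln (real n))) = ereal c"
        by (intro lim_imp_Limsup) auto
      then show ?thesis using ac by simp
    qed
    have "liminf (\<lambda>n. ereal (?pc n (\<psi> n))) \<ge> 1"
      by (rule hyp[unfolded planted_clique_hypothesis_def, THEN spec[of _ k], THEN spec[of _ \<psi>],
            THEN mp, OF k, THEN mp, OF poly, THEN mp, OF limsup])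
    moreover have "(\<lambda>n. error_bound s a c m (Suc n)) \<longlonglongrightarrow> 0"
      by (rule LIMSEQ_Suc[OF error_bound_tendsto(1)[OF s(1) ac(1) s(2)]])
    moreover have "\<forall>\<^sub>F n in sequentially. ?pc (Suc n) (\<psi> (Suc n)) \<le> ?err (Suc n) + error_bound s a c m (Suc n)"
    proof -
      have "\<forall>\<^sub>F n in sequentially. good (Suc n)"
        using ev_good by (rule eventually_compose_filterlim[OF _ filterlim_Suc])
      then show ?thesis
      proof eventually_elim
        case (elim n)
        then show ?case using F(2)[of "Suc n"] by (simp add: \<psi>_def)
      qed
    qed
    ultimately have "liminf (\<lambda>n. ereal (?err (Suc n))) \<ge> 1"
      by (rule liminf_ge_1_transfer)
    then show ?thesis by simp
  qed
  moreover have "pds_sequence \<alpha> \<beta> (\<lambda>l. N (Suc l)) (\<lambda>l. K (Suc l)) (\<lambda>l. q (Suc l))"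
    unfolding N_def K_def k_def q_def
    using \<alpha> ac by (intro pds_sequence_powr) auto
  ultimately show ?thesis
    by (intro exI[of _ "\<lambda>l. N (Suc l)"] exI[of _ "\<lambda>l. K (Suc l)"] exI[of _ "\<lambda>l. q (Suc l)"])
      simp
qed

theorem theorem1:
  shows "(\<forall>(\<gamma>::real) (\<alpha>::real) (\<beta>::real) (m0::int).
            0 < \<gamma> \<and> \<gamma> \<le> 1 / 2 \<and> planted_clique_hypothesis \<gamma> \<and>
            m0 = \<lfloor>log 2 (1 / \<gamma>)\<rfloor> \<and>
            0 < \<alpha> \<and> 0 < \<beta> \<and> \<beta> < 1 \<and>
            \<alpha> < \<beta> \<and>
            \<beta> < 1 / 2 + (of_int m0 * \<alpha> + 4) / (4 * of_int m0 * \<alpha> + 4) * \<alpha> - 2 / (of_int m0 * \<alpha>) \<longrightarrow>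
            (\<exists>N K q. pds_sequence \<alpha> \<beta> N K q \<and>
               (\<forall>\<phi>. polynomial_time_tests N \<phi> \<longrightarrow>
                  liminf (\<lambda>l. ereal (error_sum
                    (erdos_renyi (N l) (q l))
                    (planted_dense_subgraph (N l) (K l) (2 * q l) (q l)) (\<phi> l))) \<ge> 1)))
       \<and>
         ((\<forall>\<gamma>::real. 0 < \<gamma> \<and> \<gamma> \<le> 1 / 2 \<longrightarrow> planted_clique_hypothesis \<gamma>) \<longrightarrow>
          (\<forall>(\<alpha>::real) (\<beta>::real).
            0 < \<alpha> \<and> 0 < \<beta> \<and> \<beta> < 1 \<and>
            \<alpha> < \<beta> \<and> \<beta> < 1 / 2 + \<alpha> / 4 \<longrightarrow>
            (\<exists>N K q. pds_sequence \<alpha> \<beta> N K q \<and>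
               (\<forall>\<phi>. polynomial_time_tests N \<phi> \<longrightarrow>
                  liminf (\<lambda>l. ereal (error_sum
                    (erdos_renyi (N l) (q l))
                    (planted_dense_subgraph (N l) (K l) (2 * q l) (q l)) (\<phi> l))) \<ge> 1))))"
proof (rule conjI; intro allI impI; (elim conjE)?)
  fix \<gamma> \<alpha> \<beta> :: real and m0 :: int
  assume \<gamma>: "0 < \<gamma>" "\<gamma> \<le> 1 / 2" and hyp: "planted_clique_hypothesis \<gamma>"
    and m0: "m0 = \<lfloor>log 2 (1 / \<gamma>)\<rfloor>" and \<alpha>\<beta>: "0 < \<alpha>" "\<beta> < 1" "\<alpha> < \<beta>"
    and bound: "\<beta> < 1 / 2 + (of_int m0 * \<alpha> + 4) / (4 * of_int m0 * \<alpha> + 4) * \<alpha> - 2 / (of_int m0 * \<alpha>)"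
  have "log 2 2 \<le> log 2 (1 / \<gamma>)" using \<gamma> by (intro log_mono) (auto simp: field_simps)
  then have m0_pos: "1 \<le> m0" unfolding m0 by (simp add: le_floor_iff)
  define m where "m = nat m0"
  have m: "of_int m0 = real m" "0 < m" using m0_pos by (auto simp: m_def)
  \<comment> \<open>The floor is used only through \<open>2 ^ m \<le> 1 / \<gamma>\<close>.\<close>
  have "2 powr real m \<le> 2 powr (log 2 (1 / \<gamma>))"
    unfolding m(1)[symmetric] m0 by (intro powr_mono) auto
  then have "\<gamma> * 2 ^ m \<le> 1" using \<gamma> by (simp add: powr_realpow field_simps)
  then show "\<exists>N K q. pds_sequence \<alpha> \<beta> N K q \<and>
    (\<forall>\<phi>. polynomial_time_tests N \<phi> \<longrightarrow>
      liminf (\<lambda>l. ereal (error_sum (erdos_renyi (N l) (q l))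
        (planted_dense_subgraph (N l) (K l) (2 * q l) (q l)) (\<phi> l))) \<ge> 1)"
    using hyp \<gamma> \<alpha>\<beta> m(2) bound[unfolded m(1)] by (intro pds_hardness) auto
next
  fix \<alpha> \<beta> :: real
  assume hyp: "\<forall>\<gamma>::real. 0 < \<gamma> \<and> \<gamma> \<le> 1 / 2 \<longrightarrow> planted_clique_hypothesis \<gamma>"
    and \<alpha>\<beta>: "0 < \<alpha>" "\<beta> < 1" "\<alpha> < \<beta>" "\<beta> < 1 / 2 + \<alpha> / 4"
  obtain m :: nat where m: "0 < m"
    "\<beta> < 1 / 2 + (m * \<alpha> + 4) / (4 * m * \<alpha> + 4) * \<alpha> - 2 / (m * \<alpha>)"
    using exponents_exist_large[OF \<alpha>\<beta>(1,4)] .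
  \<comment> \<open>Every positive integer \<open>m\<close> is available:
    \<open>\<gamma> = (1 / 2) ^ m\<close> gives \<open>\<gamma> * 2 ^ m = 1\<close>.\<close>
  have \<gamma>: "(1 / 2) ^ m \<le> (1 / 2 :: real) ^ 1" using m(1) by (intro power_decreasing) auto
  then show "\<exists>N K q. pds_sequence \<alpha> \<beta> N K q \<and>
    (\<forall>\<phi>. polynomial_time_tests N \<phi> \<longrightarrow>
      liminf (\<lambda>l. ereal (error_sum (erdos_renyi (N l) (q l))
        (planted_dense_subgraph (N l) (K l) (2 * q l) (q l)) (\<phi> l))) \<ge> 1)"
    using hyp \<alpha>\<beta> m by (intro pds_hardness[of "(1 / 2) ^ m" m]) (auto simp: power_one_over)
qed

end
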